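(* For every $\varepsilon>0$ there exists a positive constant $C_{\varepsilon}$ (depending only on $\varepsilon$) such that the following holds. For every real $\alpha$ with $0<\alpha<1$, every integer $N\ge 3$ and every $N$-tuple of distinct positive integers $n_1,n_2,\dots,n_N$, $$\frac{1}{N}\sum_{k,\ell=1}^N\frac{(\gcd(n_k,n_{\ell}))^{2\alpha}}{(n_k n_{\ell})^\alpha}\le C_{\varepsilon}\exp\bigl((1+\varepsilon)\,g(\alpha,N)\bigr),$$ where $$g(\alpha,N)=\left(\frac{8}{1-\alpha}+\frac{16\cdot 2^{-\alpha}}{\sqrt{2\alpha-1}}\right)(\log N)^{1-\alpha}(\log\log N)^{-\alpha}+\frac{1}{1-\alpha}(\log N)^{(1-\alpha)/2}\quad\text{if } 1/2<\alpha<1,$$ and $$g(\alpha,N)=50\,\alpha\,(\log N\,\log\log N)^{1/2}+(1-2\alpha)\log N\quad\text{if } 0<\alpha\le 1/2.$$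
   Context: $\log$ denotes the natural logarithm. *)

theory Defs
  imports Complex_Main
begin

definition gcd_sum :: "real \<Rightarrow> nat \<Rightarrow> (nat \<Rightarrow> nat) \<Rightarrow> real" where
  "gcd_sum \<alpha> N n =
     (\<Sum>k = 1..N. \<Sum>l = 1..N.
        real (gcd (n k) (n l)) powr (2 * \<alpha>) / (real (n k) * real (n l)) powr \<alpha>)"

text \<open>The exponent in the bound; only its values for \<open>0 < \<alpha> < 1\<close> and \<open>N \<ge> 3\<close> are
  meaningful. For such \<open>N\<close> both \<open>ln N\<close> and \<open>ln (ln N)\<close> are positive.\<close>

definition g :: "real \<Rightarrow> nat \<Rightarrow> real" where
  "g \<alpha> N =
     (if 1/2 < \<alpha>
      then (8 / (1 - \<alpha>) + 16 * 2 powr (- \<alpha>) / sqrt (2 * \<alpha> - 1))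
             * ln (real N) powr (1 - \<alpha>) * ln (ln (real N)) powr (- \<alpha>)
           + 1 / (1 - \<alpha>) * ln (real N) powr ((1 - \<alpha>) / 2)
      else 50 * \<alpha> * sqrt (ln (real N) * ln (ln (real N)))
           + (1 - 2 * \<alpha>) * ln (real N))"

end

(* Fix an integer k >= 1 and average over characters X(n) = prod_p X_p^v_p(n), each X_p running
independently over a large group of roots of unity. With D = sum X(n_j) and the truncated Euler
product F = prod_p |sum_{a <= A} (X_p / p^alpha)^a|^2, the average of F |D|^2 dominates the GCD sum,
while the average of |D|^2 is N. Jensen's inequality for t^k and |D| <= N then bound (GCD sum / N)^k
by N times the average of F^k, and each local factor is at most
min((1 - p^-alpha)^(-2k), (1 - p^(-2 alpha))^(-k^2)). For alpha > 1/2, the first bound is used for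
primes up to y = log N log log N and the second beyond, with k about sqrt(2 alpha - 1) y^alpha / 2,
and Chebyshev's estimate theta(n) <= n log 4 controls the sums over primes. For alpha <= 1/2,
power means reduce the sum to an exponent just above 1/2, where the second bound suffices for all
primes. *)

theory Submission
  imports Defs "HOL-Analysis.Analysis" "HOL-Computational_Algebra.Primes" "HOL-Computational_Algebra.Polynomial"
begin

section \<open>Moments of local factors over roots of unity\<close>

text \<open>After taking logarithms and dividing by k, the first local bound costs about 2
  p^-\<alpha> per prime whatever k is, the second about k p^(-2 \<alpha>), and the factor N costs
  log N / k. Hence k should be large, and only the primes beyond y pay for it. For y = log N log log
  N one has y^(1 - \<alpha>) / log log N = log N / y^\<alpha> = (log N)^(1 - \<alpha>) (log log
  N)^(-\<alpha>), so the primes near y, the tail and the factor N all reach the same order. The tail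
  loses 1 / (2 \<alpha> - 1); the factor sqrt (2 \<alpha> - 1) in k shares this loss evenly with log
  N / k. If 2 \<alpha> - 1 <= 1 / sqrt (log N), such a k may fall below 1, but then the coefficient
  1 / sqrt (2 \<alpha> - 1) is large enough for the estimate at 1/2 to suffice. Nothing limits the
  primes dividing the n_j, so bounds on sums over primes have to be uniform over finite sets of
  primes. Roots of unity take the place of the circle so that averages are finite sums; they are
  exact once the order of the group exceeds every exponent that occurs.\<close>

lemma sum_rotate: "(\<Sum>j\<in>J. \<Sum>a\<in>A. \<Sum>b\<in>B. f j a b) = (\<Sum>a\<in>A. \<Sum>b\<in>B. \<Sum>j\<in>J. f j a b)"
proof -
  have "(\<Sum>j\<in>J. \<Sum>a\<in>A. \<Sum>b\<in>B. f j a b) = (\<Sum>a\<in>A. \<Sum>j\<in>J. \<Sum>b\<in>B. f j a b)"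
    by (rule sum.swap)
  also have "\<dots> = (\<Sum>a\<in>A. \<Sum>b\<in>B. \<Sum>j\<in>J. f j a b)"
    by (intro sum.cong refl sum.swap)
  finally show ?thesis .
qed

definition unity_root :: "nat \<Rightarrow> nat \<Rightarrow> complex" where
  "unity_root R j = cis (2 * pi * real j / real R)"

lemma norm_unity_root [simp]: "norm (unity_root R j) = 1"
  by (simp add: unity_root_def)

text \<open>Both exponents lie below R, so R divides c - d only if c = d; otherwise the terms are
  the powers of an R-th root of unity other than 1, whose geometric sum vanishes.\<close>

lemma unity_root_orthogonal:
  assumes "c < R" "d < R"
  shows "(\<Sum>j<R. unity_root R j ^ c * cnj (unity_root R j) ^ d) = (if c = d then of_nat R else 0)"
proof -
  define t where "t = 2 * pi * (real c - real d) / real R"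
  have R: "R > 0" using assms by simp
  have powers: "unity_root R j ^ c * cnj (unity_root R j) ^ d = cis t ^ j" for j
    using R by (simp add: unity_root_def cis_cnj Complex.DeMoivre cis_mult t_def field_simps)
  show ?thesis
  proof (cases "c = d")
    case True
    then show ?thesis using powers by (simp add: t_def)
  next
    case False
    have "cis t \<noteq> 1"
    proof
      assume "cis t = 1"
      then have "cos t = 1" by (simp add: complex_eq_iff)
      then obtain n :: int where "t = of_int n * 2 * pi"
        by (auto simp: cos_one_2pi_int)
      then have "(2 * pi) * (real c - real d) = (2 * pi) * (of_int n * real R)"
        using R by (simp add: t_def field_simps)
      then have "real c - real d = of_int n * real R"
        by (subst (asm) mult_cancel_left) simp
      then have n: "int c - int d = n * int R"
        by (metis of_int_diff of_int_eq_iff of_int_mult of_int_of_nat_eq)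
      have "\<bar>int c - int d\<bar> < int R" using assms by simp
      then have "\<bar>n\<bar> * int R < 1 * int R" by (simp add: n abs_mult)
      then have "n = 0" using R by simp
      with n False show False by simp
    qed
    moreover have "cis t ^ R = 1"
    proof -
      have "real R * t = 2 * pi * (of_int (int c - int d))"
        using R by (simp add: t_def)
      then have "cis t ^ R = cis (2 * pi * (of_int (int c - int d)))"
        by (simp only: Complex.DeMoivre)
      also have "\<dots> = 1" by (rule cis_multiple_2pi) simp
      finally show ?thesis .
    qed
    ultimately have "(\<Sum>j<R. cis t ^ j) = 0"
      by (simp add: sum_gp_strict)
    then show ?thesis using powers False by simp
  qed
qed

text \<open>Exponents up to M < R are distinct modulo R, so expanding the square leaves only the
  diagonal.\<close>

lemma unity_root_parseval:
  assumes "M < R"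
  shows "(\<Sum>j<R. (norm (\<Sum>a\<le>M. u a * unity_root R j ^ a))\<^sup>2) = real R * (\<Sum>a\<le>M. (norm (u a))\<^sup>2)"
proof -
  have "complex_of_real (\<Sum>j<R. (norm (\<Sum>a\<le>M. u a * unity_root R j ^ a))\<^sup>2) =
     (\<Sum>j<R. \<Sum>a\<le>M. \<Sum>b\<le>M. u a * cnj (u b) * (unity_root R j ^ a * cnj (unity_root R j) ^ b))"
    by (simp add: complex_norm_square sum_product mult_ac del: of_real_power)
  also have "\<dots> = (\<Sum>a\<le>M. \<Sum>b\<le>M. \<Sum>j<R. u a * cnj (u b) * (unity_root R j ^ a * cnj (unity_root R j) ^ b))"
    by (rule sum_rotate)
  also have "\<dots> = (\<Sum>a\<le>M. \<Sum>b\<le>M. u a * cnj (u b) * (if a = b then of_nat R else 0))"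
    using assms by (intro sum.cong refl) (simp add: sum_distrib_left [symmetric] unity_root_orthogonal)
  also have "\<dots> = (\<Sum>a\<le>M. u a * cnj (u a) * of_nat R)"
    by (intro sum.cong refl) (simp add: if_distrib sum.delta' cong: if_cong)
  also have "\<dots> = complex_of_real (real R * (\<Sum>a\<le>M. (norm (u a))\<^sup>2))"
    by (simp add: complex_norm_square sum_distrib_left mult_ac del: of_real_power)
  finally show ?thesis by (simp only: of_real_eq_iff)
qed

text \<open>The local Euler factor 1 / (1 - r x), later with r = p^-\<alpha>, cut off at A: being a
  polynomial, it can be averaged exactly over a finite group of roots of unity.\<close>

definition geom :: "nat \<Rightarrow> real \<Rightarrow> complex \<Rightarrow> complex" where
  "geom A r x = (\<Sum>a\<le>A. of_real (r ^ a) * x ^ a)"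

text \<open>Expanding the square and using orthogonality leaves the nonnegative terms r^(a + b) with
  a + v = b + w. Keeping only a = w - v and b = v - w, in truncated subtraction, gives the bound,
  and r^|v - w| is the local factor of the GCD quotient. Exponents reach 2 A, whence the condition
  on R. That the moment is real is part of the claim, so that products over primes can be
  compared.\<close>

lemma geom_twisted_moment:
  assumes "0 \<le> r" "v \<le> A" "w \<le> A" "2 * A < R"
  obtains W where "W \<ge> r ^ ((v - w) + (w - v))"
    "(\<Sum>j<R. of_real ((norm (geom A r (unity_root R j)))\<^sup>2) * (unity_root R j ^ v * cnj (unity_root R j) ^ w))
       = complex_of_real (real R * W)"
proof -
  define W where "W = (\<Sum>(a,b)\<in>{..A}\<times>{..A}. if a + v = b + w then r ^ (a + b) else 0)"
  have "r ^ ((v - w) + (w - v)) = (\<Sum>(a,b)\<in>{(w - v, v - w)}. if a + v = b + w then r ^ (a + b) else 0)"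
    by (auto simp: add.commute)
  also have "\<dots> \<le> W"
    unfolding W_def using assms by (intro sum_mono2) (auto split: if_splits)
  finally have 1: "r ^ ((v - w) + (w - v)) \<le> W" .
  have "(\<Sum>j<R. of_real ((norm (geom A r (unity_root R j)))\<^sup>2) * (unity_root R j ^ v * cnj (unity_root R j) ^ w))
     = (\<Sum>j<R. \<Sum>a\<le>A. \<Sum>b\<le>A. of_real (r ^ (a + b)) * (unity_root R j ^ (a + v) * cnj (unity_root R j) ^ (b + w)))"
    unfolding complex_norm_square geom_def cnj_sum sum_product sum_distrib_right
    by (intro sum.cong refl) (simp add: power_add mult_ac sum_distrib_left)
  also have "\<dots> = (\<Sum>a\<le>A. \<Sum>b\<le>A. \<Sum>j<R. of_real (r ^ (a + b)) * (unity_root R j ^ (a + v) * cnj (unity_root R j) ^ (b + w)))"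
    by (rule sum_rotate)
  also have "\<dots> = (\<Sum>a\<le>A. \<Sum>b\<le>A. of_real (r ^ (a + b)) * (if a + v = b + w then of_nat R else 0))"
    unfolding sum_distrib_left [symmetric] using assms
    by (intro sum.cong refl, subst unity_root_orthogonal) auto
  also have "\<dots> = complex_of_real (real R * W)"
    unfolding W_def sum.cartesian_product [symmetric]
    by (simp add: sum_distrib_left if_distrib mult_ac cong: if_cong)
  finally show ?thesis using 1 that by blast
qed

section \<open>Two bounds for the power moments of a local factor\<close>

lemma norm_geom_le:
  assumes "0 \<le> r" "r < 1" "norm x \<le> 1"
  shows "norm (geom A r x) \<le> 1 / (1 - r)"
proof -
  have "norm (geom A r x) \<le> (\<Sum>a\<le>A. r ^ a)"
    unfolding geom_def using assms
    by (intro sum_norm_le) (auto simp: norm_mult norm_power mult_left_le power_le_one)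
  also have "\<dots> = (1 - r ^ Suc A) / (1 - r)"
    using assms by (subst sum_gp0) auto
  also have "\<dots> \<le> 1 / (1 - r)"
    using assms by (intro divide_right_mono) auto
  finally show ?thesis .
qed

text \<open>The majorant is the n-th coefficient of (1 - r x)^(-k), as truncation only drops
  nonnegative terms. One more factor sums the binomial coefficients along a diagonal.\<close>

lemma coeff_geometric_power:
  fixes p :: "complex poly"
  assumes "p = (\<Sum>a\<le>A. monom (of_real (r ^ a)) a)" "0 \<le> r"
  shows "norm (coeff (p ^ k) n) \<le> real ((n + k - 1) choose n) * r ^ n"
proof (induction k arbitrary: n)
  case 0
  then show ?case using assms(2) by (cases n) auto
next
  case (Suc k)
  have cp: "norm (coeff p i) \<le> r ^ i" for i
    using assms by (auto simp: coeff_sum norm_power)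
  have "norm (coeff (p ^ Suc k) n) = norm (\<Sum>i\<le>n. coeff (p ^ k) i * coeff p (n - i))"
    by (simp only: power_Suc2 coeff_mult)
  also have "\<dots> \<le> (\<Sum>i\<le>n. real ((i + k - 1) choose i) * r ^ n)"
  proof (rule sum_norm_le)
    fix i assume i: "i \<in> {..n}"
    have "norm (coeff (p ^ k) i * coeff p (n - i)) \<le> (real ((i + k - 1) choose i) * r ^ i) * r ^ (n - i)"
      unfolding norm_mult using Suc.IH cp by (intro mult_mono) (use assms in auto)
    also have "\<dots> = real ((i + k - 1) choose i) * r ^ n"
      using i by (simp flip: power_add)
    finally show "norm (coeff (p ^ k) i * coeff p (n - i)) \<le> real ((i + k - 1) choose i) * r ^ n" .
  qed
  also have "\<dots> = real (\<Sum>i\<le>n. (i + k - 1) choose i) * r ^ n"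
    by (simp add: sum_distrib_right)
  also have "(\<Sum>i\<le>n. (i + k - 1) choose i) = (n + Suc k - 1) choose n"
  \<comment> \<open>For k = 0 truncated subtraction makes the binomial coefficient 1 at i = 0 and 0
    elsewhere, as the constant polynomial 1 requires; the hockey-stick identity takes over from k =
    1 on.\<close>
  proof (cases k)
    case 0
    have "(\<Sum>i\<le>n. (i + k - 1) choose i) = (\<Sum>i\<le>n. if i = 0 then 1 else 0)"
      by (intro sum.cong refl) (auto simp: 0)
    then show ?thesis using 0 by simp
  next
    case (Suc m)
    then show ?thesis using sum_choose_lower[of m n] by (simp add: add.commute)
  qed
  finally show ?case .
qed

text \<open>Induction by the ratio of consecutive terms: the claim reduces to (a + k)^2 <= (a + 1)
  (a + k^2), whose two sides differ by a (k - 1)^2. It bounds the squared coefficients of (1 -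
  x)^(-k) by the coefficients of (1 - x)^(-k^2).\<close>

lemma binomial_square_le:
  assumes "k \<ge> 1"
  shows "(real ((a + k - 1) choose a))\<^sup>2 \<le> real ((a + k\<^sup>2 - 1) choose a)"
proof (induction a)
  case 0
  then show ?case by simp
next
  case (Suc a)
  have step: "real (Suc a) * real ((Suc a + m - 1) choose Suc a) = real (a + m) * real ((a + m - 1) choose a)"
    if "m \<ge> 1" for m
  proof -
    have "Suc a * ((Suc a + m - 1) choose Suc a) = (a + m) * ((a + m - 1) choose a)"
      using Suc_times_binomial[of a "a + m - 1"] that by simp
    then show ?thesis by (simp only: flip: of_nat_mult)
  qed
  have k: "(1::nat) \<le> k\<^sup>2" using assms by simp
  have "(real (Suc a))\<^sup>2 * (real ((Suc a + k - 1) choose Suc a))\<^sup>2 = (real (a + k))\<^sup>2 * (real ((a + k - 1) choose a))\<^sup>2"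
    unfolding power_mult_distrib [symmetric] step[OF assms] ..
  also have "\<dots> \<le> (real (Suc a) * real (a + k\<^sup>2)) * real ((a + k\<^sup>2 - 1) choose a)"
  proof (rule mult_mono [OF _ Suc.IH])
    have "0 \<le> real a * (real k - 1)\<^sup>2" by simp
    then show "(real (a + k))\<^sup>2 \<le> real (Suc a) * real (a + k\<^sup>2)"
      by (simp add: algebra_simps power2_eq_square)
  qed auto
  also have "\<dots> = (real (Suc a))\<^sup>2 * real ((Suc a + k\<^sup>2 - 1) choose Suc a)"
    using step[OF k] by (simp add: power2_eq_square mult_ac)
  finally show ?case
    by (rule mult_left_le_imp_le) simp
qed

lemma negative_binomial_partial_sum_le:
  assumes "0 \<le> s" "s < (1::real)" "m \<ge> 1"
  shows "(\<Sum>a\<le>M. real ((a + m - 1) choose a) * s ^ a) \<le> (1 / (1 - s)) ^ m"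
proof -
  have "(\<lambda>n. ((- real m) gchoose n) * (- s) ^ n) sums (1 + (- s)) powr (- real m)"
    using assms by (intro gen_binomial_real) auto
  moreover have "((- real m) gchoose n) * (- s) ^ n = real ((n + m - 1) choose n) * s ^ n" for n
  proof -
    have "((- real m) gchoose n) * (- s) ^ n = (of_nat n + real m - 1 gchoose n) * s ^ n"
    proof -
      have "(-1 :: real) ^ n * (- s) ^ n = s ^ n" by (simp flip: power_mult_distrib)
      then show ?thesis by (simp add: gbinomial_negated_upper[of "- real m"] mult_ac)
    qed
    also have "of_nat n + real m - 1 = real (n + m - 1)"
      using assms by (simp add: of_nat_diff)
    finally show ?thesis by (simp add: binomial_gbinomial)
  qed
  ultimately have *: "(\<lambda>n. real ((n + m - 1) choose n) * s ^ n) sums (1 / (1 - s)) ^ m"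
    using assms by (simp add: powr_minus powr_realpow power_one_over inverse_eq_divide)
  have "(\<Sum>a\<le>M. real ((a + m - 1) choose a) * s ^ a) \<le> (\<Sum>a. real ((a + m - 1) choose a) * s ^ a)"
    using * assms by (intro sum_le_suminf) (auto simp: sums_iff)
  then show ?thesis using * by (simp add: sums_iff)
qed

text \<open>The summand is the squared modulus of the k-th power of \<open>geom\<close>, a
  polynomial of degree at most k A < R, so Parseval turns the sum into squared coefficients, which
  the series of (1 - r^2)^(-k^2) majorizes.\<close>

lemma geom_moment_le:
  assumes "0 \<le> r" "r < 1" "k \<ge> 1" "k * A < R"
  shows "(\<Sum>j<R. (norm (geom A r (unity_root R j)))\<^sup>2 ^ k) \<le> real R * (1 / (1 - r\<^sup>2)) ^ k\<^sup>2"
proof -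
  define p :: "complex poly" where "p = (\<Sum>a\<le>A. monom (of_real (r ^ a)) a)"
  have "degree p \<le> A"
    unfolding p_def by (intro degree_sum_le) (auto intro: order.trans[OF degree_monom_le])
  then have deg: "degree (p ^ k) \<le> k * A"
    by (intro order.trans[OF degree_power_le]) (simp add: mult.commute)
  have "(norm (geom A r x))\<^sup>2 ^ k = (norm (\<Sum>a\<le>k * A. coeff (p ^ k) a * x ^ a))\<^sup>2" for x
  proof -
    have "poly p x = geom A r x"
      by (simp add: p_def geom_def poly_sum poly_monom)
    then have "geom A r x ^ k = poly (p ^ k) x" by simp
    also have "\<dots> = (\<Sum>a\<le>k * A. coeff (p ^ k) a * x ^ a)"
      unfolding poly_altdef using deg by (intro sum.mono_neutral_left) (auto simp: coeff_eq_0)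
    finally have "norm (geom A r x) ^ k = norm (\<Sum>a\<le>k * A. coeff (p ^ k) a * x ^ a)"
      by (simp flip: norm_power)
    then show ?thesis by (metis power_mult mult.commute)
  qed
  then have "(\<Sum>j<R. (norm (geom A r (unity_root R j)))\<^sup>2 ^ k) = real R * (\<Sum>a\<le>k * A. (norm (coeff (p ^ k) a))\<^sup>2)"
    using unity_root_parseval[OF assms(4)] by simp
  also have "(\<Sum>a\<le>k * A. (norm (coeff (p ^ k) a))\<^sup>2) \<le> (\<Sum>a\<le>k * A. real ((a + k\<^sup>2 - 1) choose a) * (r\<^sup>2) ^ a)"
  proof (rule sum_mono)
    fix a
    have "(norm (coeff (p ^ k) a))\<^sup>2 \<le> (real ((a + k - 1) choose a) * r ^ a)\<^sup>2"
      using coeff_geometric_power[OF p_def assms(1)] by (intro power_mono) auto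
    also have "\<dots> = (real ((a + k - 1) choose a))\<^sup>2 * (r\<^sup>2) ^ a"
      by (simp add: power_mult_distrib power_mult [symmetric] mult.commute)
    also have "\<dots> \<le> real ((a + k\<^sup>2 - 1) choose a) * (r\<^sup>2) ^ a"
      using binomial_square_le[OF assms(3)] by (intro mult_right_mono) auto
    finally show "(norm (coeff (p ^ k) a))\<^sup>2 \<le> \<dots>" .
  qed
  also have "\<dots> \<le> (1 / (1 - r\<^sup>2)) ^ k\<^sup>2"
    using assms by (intro negative_binomial_partial_sum_le) (auto simp: power_less_one_iff abs_square_less_1)
  finally show ?thesis by (simp add: mult_left_mono)
qed

section \<open>Moment bound for GCD sums\<close>

lemma prod_prime_powers:
  assumes "finite P" "\<And>p. p \<in> P \<Longrightarrow> prime p" "prime_factors x \<subseteq> P" "x > 0"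
  shows "(\<Prod>p\<in>P. real p ^ multiplicity p x) = real (x::nat)"
proof -
  have "(\<Prod>p\<in>P. p ^ multiplicity p x) = (\<Prod>p\<in>prime_factors x. p ^ multiplicity p x)"
  proof (rule prod.mono_neutral_right)
    show "\<forall>p\<in>P - prime_factors x. p ^ multiplicity p x = 1"
    proof
      fix p assume "p \<in> P - prime_factors x"
      then have "\<not> p dvd x" using assms by (auto simp: prime_factors_dvd)
      then show "p ^ multiplicity p x = 1" by (simp add: not_dvd_imp_multiplicity_0)
    qed
  qed (use assms in auto)
  also have "\<dots> = x" using assms by (simp add: prod_prime_factors)
  finally show ?thesis by (metis (mono_tags, lifting) of_nat_power of_nat_prod prod.cong)
qed

text \<open>For each prime, 2 min v w - v - w = -|v - w|, and (v - w) + (w - v) is |v - w| in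
  truncated subtraction. This factorization lets every prime be treated separately.\<close>

lemma gcd_quotient_eq_prod:
  assumes "finite P" "\<And>p. p \<in> P \<Longrightarrow> prime p"
    and "prime_factors m \<subseteq> P" "prime_factors n \<subseteq> P" "m > 0" "n > 0"
  shows "real (gcd m n) powr (2 * \<alpha>) / (real m * real n) powr \<alpha> =
    (\<Prod>p\<in>P. (real p powr (- \<alpha>)) ^ ((multiplicity p m - multiplicity p n) + (multiplicity p n - multiplicity p m)))"
proof -
  have gcd_pf: "prime_factors (gcd m n) \<subseteq> P"
    using assms by (auto simp: prime_factors_dvd)
  have "real (gcd m n) powr (2 * \<alpha>) / (real m * real n) powr \<alpha> =
     (\<Prod>p\<in>P. real p ^ multiplicity p (gcd m n)) powr (2 * \<alpha>) /
       ((\<Prod>p\<in>P. real p ^ multiplicity p m) * (\<Prod>p\<in>P. real p ^ multiplicity p n)) powr \<alpha>"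
    using assms gcd_pf by (simp add: prod_prime_powers)
  also have "\<dots> = (\<Prod>p\<in>P. (real p ^ multiplicity p (gcd m n)) powr (2 * \<alpha>)) /
       (\<Prod>p\<in>P. (real p ^ multiplicity p m * real p ^ multiplicity p n) powr \<alpha>)"
    by (simp add: prod.distrib[symmetric] prod_powr_distrib)
  also have "\<dots> = (\<Prod>p\<in>P. (real p ^ multiplicity p (gcd m n)) powr (2 * \<alpha>) / (real p ^ multiplicity p m * real p ^ multiplicity p n) powr \<alpha>)"
    by (simp add: prod_dividef)
  also have "\<dots> = (\<Prod>p\<in>P. (real p powr (- \<alpha>)) ^ ((multiplicity p m - multiplicity p n) + (multiplicity p n - multiplicity p m)))"
  proof (rule prod.cong [OF refl])
    fix p assume pP: "p \<in> P"
    then have p: "real p > 0" using assms(2) prime_gt_0_nat by fastforce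
    define v w where "v = multiplicity p m" and "w = multiplicity p n"
    have mg: "multiplicity p (gcd m n) = min v w"
      unfolding v_def w_def using assms pP by (subst multiplicity_gcd) auto
    have "(real p ^ min v w) powr (2 * \<alpha>) / (real p ^ v * real p ^ w) powr \<alpha>
      = real p powr (real (min v w) * (2 * \<alpha>) - real (v + w) * \<alpha>)"
      using p by (simp add: powr_realpow[symmetric] powr_powr powr_diff powr_add[symmetric] del: of_nat_add)
        (simp flip: of_nat_add)
    also have "real (min v w) * (2 * \<alpha>) - real (v + w) * \<alpha> = (- \<alpha>) * real ((v - w) + (w - v))"
      by (cases "v \<le> w") (auto simp: min_def of_nat_diff algebra_simps)
    also have "real p powr \<dots> = (real p powr (- \<alpha>)) ^ ((v - w) + (w - v))"
      using p by (subst powr_realpow[symmetric]) (auto simp: powr_powr)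
    finally show "(real p ^ multiplicity p (gcd m n)) powr (2 * \<alpha>) / (real p ^ multiplicity p m * real p ^ multiplicity p n) powr \<alpha>
      = (real p powr (- \<alpha>)) ^ ((multiplicity p m - multiplicity p n) + (multiplicity p n - multiplicity p m))"
      unfolding mg v_def w_def .
  qed
  finally show ?thesis .
qed

section \<open>Averaging over characters\<close>

lemma weighted_power_mean:
  fixes w F :: "'a \<Rightarrow> real"
  assumes "finite S" "\<And>i. i \<in> S \<Longrightarrow> 0 \<le> w i" "\<And>i. i \<in> S \<Longrightarrow> 0 \<le> F i"
    and W: "W = (\<Sum>i\<in>S. w i)" "W > 0"
  shows "((\<Sum>i\<in>S. w i * F i) / W) ^ k \<le> (\<Sum>i\<in>S. w i * F i ^ k) / W"
proof -
  have "S \<noteq> {}" using W by auto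
  have conv: "convex_on {0::real..} (\<lambda>x. x ^ k)"
    using convex_power_odd[of k] convex_power_even[of k] by (cases "even k") (auto intro: convex_on_subset)
  have "(\<Sum>i\<in>S. (w i / W) *\<^sub>R F i) ^ k \<le> (\<Sum>i\<in>S. (w i / W) * F i ^ k)"
    using assms \<open>S \<noteq> {}\<close> by (intro convex_on_sum[OF _ _ conv]) (auto simp flip: sum_divide_distrib)
  then show ?thesis by (simp add: sum_divide_distrib)
qed

text \<open>The tuple is replaced by the set of its values, which loses nothing because its entries
  are distinct.\<close>

definition gcd_form :: "real \<Rightarrow> nat set \<Rightarrow> real" where
  "gcd_form \<alpha> B = (\<Sum>m\<in>B. \<Sum>n\<in>B. real (gcd m n) powr (2 * \<alpha>) / (real m * real n) powr \<alpha>)"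

lemma gcd_form_power_le:
  fixes B :: "nat set"
  assumes B: "finite B" "B \<noteq> {}" "0 \<notin> B" and "\<alpha> > 0" "k \<ge> 1"
  defines "P \<equiv> \<Union>n\<in>B. prime_factors n"
  shows "(gcd_form \<alpha> B / card B) ^ k \<le> card B *
    (\<Prod>p\<in>P. min ((1 / (1 - real p powr (- \<alpha>))) ^ (2 * k)) ((1 / (1 - real p powr (- 2 * \<alpha>))) ^ k\<^sup>2))"
proof -
  have P: "finite P" "\<And>p. p \<in> P \<Longrightarrow> prime p"
    using B by (auto simp: P_def prime_factors_dvd)
  obtain A where A: "multiplicity p n \<le> A" if "p \<in> P" "n \<in> B" for p n
  proof -
    have "finite ((\<lambda>(p, n). multiplicity p n) ` (P \<times> B))" using P B by auto
    then obtain A where "\<forall>x \<in> (\<lambda>(p, n). multiplicity p n) ` (P \<times> B). x \<le> A"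
      using finite_nat_set_iff_bounded_le by blast
    then show thesis using that by force
  qed
  \<comment> \<open>Large enough for all three uses: exponents up to k A in the k-th power, 2 A in
    the twisted moment and A in plain orthogonality.\<close>
  define R where "R = k * A + 2 * A + 1"
  have R: "2 * A < R" "k * A < R" "A < R" "R > 0" by (auto simp: R_def)
  define r where "r = (\<lambda>p::nat. real p powr (- \<alpha>))"
  have r: "0 \<le> r p" "r p < 1" if "p \<in> P" for p
    using P(2)[OF that] prime_gt_1_nat[of p] \<open>\<alpha> > 0\<close> by (auto simp: r_def powr_less_one)
  define \<Omega> where "\<Omega> = PiE P (\<lambda>_. {..<R})"
  have "finite \<Omega>" using P by (auto simp: \<Omega>_def intro: finite_PiE)
  define q where "q = (\<lambda>p j. (norm (geom A (r p) (unity_root R j)))\<^sup>2)"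
  define F where "F = (\<lambda>\<omega>. \<Prod>p\<in>P. q p (\<omega> p))"
  define X where "X = (\<lambda>\<omega> n. \<Prod>p\<in>P. unity_root R (\<omega> p) ^ multiplicity p n)"
  define w where "w = (\<lambda>\<omega>. (norm (\<Sum>n\<in>B. X \<omega> n))\<^sup>2)"
  define c where "c = real R ^ card P"
  have "c > 0" using R by (simp add: c_def)
  have Fpos: "0 \<le> F \<omega>" for \<omega> by (auto simp: F_def q_def intro!: prod_nonneg)
  have w_eq: "complex_of_real (w \<omega>) = (\<Sum>m\<in>B. \<Sum>n\<in>B. X \<omega> m * cnj (X \<omega> n))" for \<omega>
    by (simp only: w_def complex_norm_square cnj_sum sum_product)
  have XX: "X \<omega> m * cnj (X \<omega> n) = (\<Prod>p\<in>P. unity_root R (\<omega> p) ^ multiplicity p m * cnj (unity_root R (\<omega> p)) ^ multiplicity p n)" for \<omega> m n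
    by (simp add: X_def prod.distrib)

  have W: "(\<Sum>\<omega>\<in>\<Omega>. w \<omega>) = c * card B"
  proof -
    have "complex_of_real (\<Sum>\<omega>\<in>\<Omega>. w \<omega>) = (\<Sum>\<omega>\<in>\<Omega>. \<Sum>m\<in>B. \<Sum>n\<in>B. X \<omega> m * cnj (X \<omega> n))"
      by (simp only: of_real_sum w_eq)
    also have "\<dots> = (\<Sum>m\<in>B. \<Sum>n\<in>B. \<Sum>\<omega>\<in>\<Omega>. X \<omega> m * cnj (X \<omega> n))"
      by (rule sum_rotate)
    also have "\<dots> = (\<Sum>m\<in>B. \<Sum>n\<in>B. if m = n then of_real c else 0)"
    proof (intro sum.cong refl)
      fix m n assume mn: "m \<in> B" "n \<in> B"
      then have pos: "m > 0" "n > 0" using B(3) by (metis gr0I)+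
      have "(\<Sum>\<omega>\<in>\<Omega>. X \<omega> m * cnj (X \<omega> n)) =
         (\<Prod>p\<in>P. \<Sum>j<R. unity_root R j ^ multiplicity p m * cnj (unity_root R j) ^ multiplicity p n)"
        unfolding XX \<Omega>_def by (intro prod_sum_PiE[symmetric] P) auto
      also have "\<dots> = (\<Prod>p\<in>P. if multiplicity p m = multiplicity p n then of_nat R else 0)"
        using mn by (intro prod.cong refl unity_root_orthogonal le_less_trans[OF A R(3)]) auto
      also have "\<dots> = (if m = n then of_real c else 0)"
      proof (cases "m = n")
        case False
        \<comment> \<open>Positive integers with equal multiplicities at all primes of P coincide,
          so distinct m and n produce a vanishing factor.\<close>
        have "\<exists>p\<in>P. multiplicity p m \<noteq> multiplicity p n"
        proof (rule ccontr)
          assume contr: "\<not> ?thesis"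
          have "real m = (\<Prod>p\<in>P. real p ^ multiplicity p m)"
            using mn pos by (intro prod_prime_powers[symmetric] P) (auto simp: P_def)
          also have "\<dots> = (\<Prod>p\<in>P. real p ^ multiplicity p n)"
            using contr by (intro prod.cong) auto
          also have "\<dots> = real n"
            using mn pos by (intro prod_prime_powers P) (auto simp: P_def)
          finally show False using False by simp
        qed
        then show ?thesis using False P by (auto simp: prod_zero_iff)
      qed (simp add: c_def)
      finally show "(\<Sum>\<omega>\<in>\<Omega>. X \<omega> m * cnj (X \<omega> n)) = (if m = n then of_real c else 0)" .
    qed
    also have "\<dots> = complex_of_real (c * card B)" using B by simp
    finally show ?thesis by (simp only: of_real_eq_iff)
  qed

  have lower: "c * gcd_form \<alpha> B \<le> (\<Sum>\<omega>\<in>\<Omega>. w \<omega> * F \<omega>)"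
  proof -
    define T where "T = (\<lambda>p m n. \<Sum>j<R. complex_of_real (q p j) *
      (unity_root R j ^ multiplicity p m * cnj (unity_root R j) ^ multiplicity p n))"
    \<comment> \<open>The lemma on twisted moments only asserts that a suitable real number exists;
      the real part names it explicitly for all p, m, n.\<close>
    define W where "W = (\<lambda>p m n. Re (T p m n) / real R)"
    have W: "W p m n \<ge> r p ^ ((multiplicity p m - multiplicity p n) + (multiplicity p n - multiplicity p m)) \<and>
        T p m n = complex_of_real (real R * W p m n)" if pmn: "p \<in> P" "m \<in> B" "n \<in> B" for p m n
    proof -
      obtain W' where W': "W' \<ge> r p ^ ((multiplicity p m - multiplicity p n) + (multiplicity p n - multiplicity p m))"
        "T p m n = complex_of_real (real R * W')"
        unfolding T_def q_def
        by (rule geom_twisted_moment[OF r(1)[OF pmn(1)] A[OF pmn(1,2)] A[OF pmn(1,3)] R(1)])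
      then have "W p m n = W'" using R by (simp add: W_def)
      with W' show ?thesis by simp
    qed
    have "complex_of_real (\<Sum>\<omega>\<in>\<Omega>. w \<omega> * F \<omega>) = (\<Sum>\<omega>\<in>\<Omega>. \<Sum>m\<in>B. \<Sum>n\<in>B. of_real (F \<omega>) * (X \<omega> m * cnj (X \<omega> n)))"
      by (simp add: w_eq sum_distrib_left mult_ac)
    also have "\<dots> = (\<Sum>m\<in>B. \<Sum>n\<in>B. \<Sum>\<omega>\<in>\<Omega>. of_real (F \<omega>) * (X \<omega> m * cnj (X \<omega> n)))"
      by (rule sum_rotate)
    also have "\<dots> = (\<Sum>m\<in>B. \<Sum>n\<in>B. of_real (c * (\<Prod>p\<in>P. W p m n)))"
    proof (intro sum.cong refl)
      fix m n assume mn: "m \<in> B" "n \<in> B"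
      have "(\<Sum>\<omega>\<in>\<Omega>. of_real (F \<omega>) * (X \<omega> m * cnj (X \<omega> n))) =
         (\<Sum>\<omega>\<in>\<Omega>. \<Prod>p\<in>P. of_real (q p (\<omega> p)) * (unity_root R (\<omega> p) ^ multiplicity p m * cnj (unity_root R (\<omega> p)) ^ multiplicity p n))"
        by (simp only: F_def XX of_real_prod prod.distrib)
      also have "\<dots> = (\<Prod>p\<in>P. \<Sum>j<R. of_real (q p j) * (unity_root R j ^ multiplicity p m * cnj (unity_root R j) ^ multiplicity p n))"
        unfolding \<Omega>_def by (intro prod_sum_PiE[symmetric] P) auto
      also have "\<dots> = (\<Prod>p\<in>P. of_real (real R * W p m n))"
        using mn W[unfolded T_def] by (intro prod.cong refl) blast
      also have "\<dots> = of_real (c * (\<Prod>p\<in>P. W p m n))"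
        by (simp add: prod.distrib c_def)
      finally show "(\<Sum>\<omega>\<in>\<Omega>. of_real (F \<omega>) * (X \<omega> m * cnj (X \<omega> n))) = of_real (c * (\<Prod>p\<in>P. W p m n))" .
    qed
    also have "\<dots> = complex_of_real (c * (\<Sum>m\<in>B. \<Sum>n\<in>B. \<Prod>p\<in>P. W p m n))"
      by (simp add: sum_distrib_left)
    finally have "(\<Sum>\<omega>\<in>\<Omega>. w \<omega> * F \<omega>) = c * (\<Sum>m\<in>B. \<Sum>n\<in>B. \<Prod>p\<in>P. W p m n)"
      by (simp only: of_real_eq_iff)
    moreover have "gcd_form \<alpha> B \<le> (\<Sum>m\<in>B. \<Sum>n\<in>B. \<Prod>p\<in>P. W p m n)"
      unfolding gcd_form_def
    proof (intro sum_mono)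
      fix m n assume mn: "m \<in> B" "n \<in> B"
      then have pos: "m > 0" "n > 0" using B(3) by (metis gr0I)+
      have "real (gcd m n) powr (2 * \<alpha>) / (real m * real n) powr \<alpha> =
         (\<Prod>p\<in>P. r p ^ ((multiplicity p m - multiplicity p n) + (multiplicity p n - multiplicity p m)))"
        unfolding r_def using mn pos by (intro gcd_quotient_eq_prod P) (auto simp: P_def)
      also have "\<dots> \<le> (\<Prod>p\<in>P. W p m n)"
        using W mn r by (intro prod_mono) auto
      finally show "real (gcd m n) powr (2 * \<alpha>) / (real m * real n) powr \<alpha> \<le> (\<Prod>p\<in>P. W p m n)" .
    qed
    ultimately show ?thesis using \<open>c > 0\<close> by simp
  qed

  have upper: "(\<Sum>\<omega>\<in>\<Omega>. F \<omega> ^ k) \<le> c * (\<Prod>p\<in>P. min ((1 / (1 - r p)) ^ (2 * k)) ((1 / (1 - (r p)\<^sup>2)) ^ k\<^sup>2))"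
  proof -
    have "(\<Sum>\<omega>\<in>\<Omega>. F \<omega> ^ k) = (\<Sum>\<omega>\<in>\<Omega>. \<Prod>p\<in>P. q p (\<omega> p) ^ k)"
      by (simp add: F_def prod_power_distrib)
    also have "\<dots> = (\<Prod>p\<in>P. \<Sum>j<R. q p j ^ k)"
      unfolding \<Omega>_def by (intro prod_sum_PiE[symmetric] P) auto
    also have "\<dots> \<le> (\<Prod>p\<in>P. real R * min ((1 / (1 - r p)) ^ (2 * k)) ((1 / (1 - (r p)\<^sup>2)) ^ k\<^sup>2))"
    proof (rule prod_mono, rule conjI)
      fix p assume p: "p \<in> P"
      have "(\<Sum>j<R. q p j ^ k) \<le> (\<Sum>j<R. (1 / (1 - r p)) ^ (2 * k))"
        unfolding q_def power_mult using r[OF p]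
        by (intro sum_mono power_mono norm_geom_le) auto
      moreover have "(\<Sum>j<R. q p j ^ k) \<le> real R * (1 / (1 - (r p)\<^sup>2)) ^ k\<^sup>2"
        unfolding q_def using r[OF p] assms R by (intro geom_moment_le) auto
      ultimately show "(\<Sum>j<R. q p j ^ k) \<le> real R * min ((1 / (1 - r p)) ^ (2 * k)) ((1 / (1 - (r p)\<^sup>2)) ^ k\<^sup>2)"
        by (simp add: min_def)
      show "0 \<le> (\<Sum>j<R. q p j ^ k)" by (auto simp: q_def intro: sum_nonneg)
    qed
    also have "\<dots> = c * (\<Prod>p\<in>P. min ((1 / (1 - r p)) ^ (2 * k)) ((1 / (1 - (r p)\<^sup>2)) ^ k\<^sup>2))"
      by (simp add: prod.distrib c_def)
    finally show ?thesis .
  qed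

  have wle: "w \<omega> \<le> (real (card B))\<^sup>2" for \<omega>
  proof -
    have "norm (\<Sum>n\<in>B. X \<omega> n) \<le> (\<Sum>n\<in>B. 1)"
      by (rule sum_norm_le) (simp add: X_def norm_power flip: prod_norm)
    then show ?thesis unfolding w_def by (intro power_mono) auto
  qed
  have N: "real (card B) > 0" using B by (simp add: card_gt_0_iff)
  have gpos: "0 \<le> gcd_form \<alpha> B" by (auto simp: gcd_form_def intro!: sum_nonneg)
  have "(gcd_form \<alpha> B / card B) ^ k = (c * gcd_form \<alpha> B / (c * card B)) ^ k"
    using \<open>c > 0\<close> by simp
  also have "\<dots> \<le> ((\<Sum>\<omega>\<in>\<Omega>. w \<omega> * F \<omega>) / (c * card B)) ^ k"
    using lower \<open>c > 0\<close> N gpos by (intro power_mono divide_right_mono) auto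
  also have "\<dots> \<le> (\<Sum>\<omega>\<in>\<Omega>. w \<omega> * F \<omega> ^ k) / (c * card B)"
    using \<open>finite \<Omega>\<close> Fpos W \<open>c > 0\<close> N by (intro weighted_power_mean) (auto simp: w_def)
  also have "\<dots> \<le> (\<Sum>\<omega>\<in>\<Omega>. (real (card B))\<^sup>2 * F \<omega> ^ k) / (c * card B)"
    using wle Fpos \<open>c > 0\<close> N by (intro divide_right_mono sum_mono mult_right_mono) auto
  also have "\<dots> = card B * ((\<Sum>\<omega>\<in>\<Omega>. F \<omega> ^ k) / c)"
    using N \<open>c > 0\<close> by (simp add: power2_eq_square flip: sum_distrib_left)
  also have "\<dots> \<le> card B * (\<Prod>p\<in>P. min ((1 / (1 - r p)) ^ (2 * k)) ((1 / (1 - (r p)\<^sup>2)) ^ k\<^sup>2))"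
    using upper \<open>c > 0\<close> by (intro mult_left_mono) (auto simp: divide_simps mult.commute)
  also have "(\<Prod>p\<in>P. min ((1 / (1 - r p)) ^ (2 * k)) ((1 / (1 - (r p)\<^sup>2)) ^ k\<^sup>2)) =
      (\<Prod>p\<in>P. min ((1 / (1 - real p powr (- \<alpha>))) ^ (2 * k)) ((1 / (1 - real p powr (- 2 * \<alpha>))) ^ k\<^sup>2))"
    by (simp add: r_def power2_eq_square flip: powr_add)
  finally show ?thesis .
qed

section \<open>Chebyshev's estimate and sums over primes\<close>

lemma prod_primes_dvd:
  fixes x :: nat
  assumes "finite S" "\<And>p. p \<in> S \<Longrightarrow> prime p" "\<And>p. p \<in> S \<Longrightarrow> p dvd x"
  shows "\<Prod>S dvd x"
  using assms
proof (induction S rule: finite_induct)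
  case (insert p S)
  have "coprime p (\<Prod>S)"
    using insert by (intro prod_coprime_right) (auto intro: primes_coprime)
  then show ?case using insert by (simp add: divides_mult)
qed simp

text \<open>The coefficient occurs twice, at m and at m + 1, in a row of sum 2 * 4^m.\<close>

lemma binomial_middle_le: "(2 * m + 1) choose m \<le> 4 ^ m"
proof -
  have "2 * ((2 * m + 1) choose m) = (\<Sum>k\<in>{m, m + 1}. (2 * m + 1) choose k)"
    using binomial_symmetric[of m "2 * m + 1"] by simp
  also have "\<dots> \<le> (\<Sum>k\<le>2 * m + 1. (2 * m + 1) choose k)"
    by (intro sum_mono2) auto
  also have "\<dots> = 2 * 4 ^ m"
    by (subst choose_row_sum) (simp add: power_mult)
  finally show ?thesis by simp
qed

text \<open>Erdos's argument: for n = 2 m + 1, every prime in (m + 1, n] divides n! but neither m!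
  nor (m + 1)!, hence divides the middle binomial coefficient, which is at most 4^m. The primes up
  to m + 1 are left to the induction, and an even n > 2 adds no prime.\<close>

lemma primorial_le: "\<Prod>{p. prime p \<and> p \<le> n} \<le> (4::nat) ^ n"
proof (induction n rule: less_induct)
  case (less n)
  consider "n \<le> 1" | "n = 2" | "even n" "n > 2" | "odd n" "n > 1" by fastforce
  then show ?case
  proof cases
    case 1
    then have "{p. prime p \<and> p \<le> n} = {}" by (auto dest: prime_gt_1_nat)
    show ?thesis unfolding \<open>{p. prime p \<and> p \<le> n} = {}\<close> by simp
  next
    case 2
    have "{p. prime p \<and> p \<le> (2::nat)} = {2}"
      by (auto dest: prime_ge_2_nat)
    then show ?thesis unfolding 2 by simp
  next
    case 3
    then have "{p. prime p \<and> p \<le> n} = {p. prime p \<and> p \<le> n - 1}"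
      by (auto simp: le_less dest: prime_odd_nat)
    then have "\<Prod>{p. prime p \<and> p \<le> n} \<le> 4 ^ (n - 1)" using less.IH[of "n - 1"] 3 by simp
    also have "\<dots> \<le> 4 ^ n" by (intro power_increasing) auto
    finally show ?thesis .
  next
    case 4
    then obtain m where m: "n = 2 * m + 1" "m \<ge> 1" by (auto elim!: oddE)
    let ?S = "{p. prime p \<and> m + 1 < p \<and> p \<le> n}"
    have "\<Prod>{p. prime p \<and> p \<le> n} = \<Prod>({p. prime p \<and> p \<le> m + 1} \<union> ?S)"
      using m by (intro arg_cong[where f = Prod]) auto
    also have "\<dots> = \<Prod>{p. prime p \<and> p \<le> m + 1} * \<Prod>?S"
      by (intro prod.union_disjoint) auto
    also have "\<dots> \<le> 4 ^ (m + 1) * 4 ^ m"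
    proof (rule mult_le_mono)
      show "\<Prod>{p. prime p \<and> p \<le> m + 1} \<le> 4 ^ (m + 1)" using m by (intro less.IH) auto
      have "\<Prod>?S dvd (n choose m)"
      proof (rule prod_primes_dvd)
        fix p assume p: "p \<in> ?S"
        have "fact m * fact (n - m) * (n choose m) = (fact n :: nat)"
          using m by (intro binomial_fact_lemma) auto
        moreover have "p dvd fact n" using p by (simp add: prime_dvd_fact_iff)
        ultimately have "p dvd fact m * fact (n - m) * (n choose m)" by simp
        moreover have "n - m = m + 1" using m by simp
        ultimately show "p dvd (n choose m)"
          using p by (auto simp: prime_dvd_mult_iff prime_dvd_fact_iff simp del: fact_Suc)
      qed auto
      then have "\<Prod>?S \<le> n choose m" using m by (intro dvd_imp_le) auto
      also have "\<dots> \<le> 4 ^ m" using binomial_middle_le m by simp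
      finally show "\<Prod>?S \<le> 4 ^ m" .
    qed
    also have "\<dots> = 4 ^ n" using m by (simp flip: power_add)
    finally show ?thesis .
  qed
qed

lemma chebyshev_theta_le: "(\<Sum>p | prime p \<and> p \<le> n. ln (real p)) \<le> ln 4 * real n"
proof -
  have pos: "p > 0" if "prime p" for p :: nat using that prime_gt_0_nat by blast
  have "(\<Sum>p | prime p \<and> p \<le> n. ln (real p)) = ln (\<Prod>p | prime p \<and> p \<le> n. real p)"
    using pos by (subst ln_prod) auto
  also have "\<dots> = ln (real (\<Prod>{p. prime p \<and> p \<le> n}))" by simp
  also have "\<dots> \<le> ln (real (4 ^ n))"
  proof (rule ln_mono)
    show "0 < real (\<Prod>{p. prime p \<and> p \<le> n})" using pos by (auto intro!: prod_pos)
    show "real (\<Prod>{p. prime p \<and> p \<le> n}) \<le> real (4 ^ n)"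
      using primorial_le[of n] by (simp only: of_nat_le_iff)
  qed
  also have "\<dots> = ln 4 * real n" by (simp add: ln_realpow)
  finally show ?thesis .
qed

section \<open>Partial summation: from primes to all integers\<close>

lemma sum_mult_antimono_nonneg:
  fixes b f :: "nat \<Rightarrow> real"
  assumes "\<And>n. 0 \<le> (\<Sum>i=1..n. b i)" "\<And>i. 1 \<le> i \<Longrightarrow> f (Suc i) \<le> f i" "\<And>i. 0 \<le> f i"
  shows "0 \<le> (\<Sum>i=1..n. b i * f i)"
proof -
  \<comment> \<open>Inductive form of summation by parts: the last value of f times the partial sum
    of b stays below the weighted sum.\<close>
  have "f n * (\<Sum>i=1..n. b i) \<le> (\<Sum>i=1..n. b i * f i)"
  proof (induction n)
    case (Suc n)
    \<comment> \<open>Monotonicity is available only from 1 on, because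
      \<open>real 0 powr (- s)\<close> is 0; for n = 0 the partial sum is empty.\<close>
    have "f (Suc n) * (\<Sum>i=1..n. b i) \<le> f n * (\<Sum>i=1..n. b i)"
      using assms by (cases "n = 0") (auto intro!: mult_right_mono)
    then show ?case using Suc by (simp add: algebra_simps)
  qed simp
  moreover have "0 \<le> f n * (\<Sum>i=1..n. b i)" using assms by simp
  ultimately show ?thesis by linarith
qed

text \<open>Summation by parts for the weight ln 4 minus ln p (the latter at primes only):
  Chebyshev's estimate says that its partial sums are nonnegative. Passing to all integers then
  costs only ln 4, while the weight ln p records the density of the primes.\<close>

lemma sum_primes_ln_mult_le:
  fixes f :: "nat \<Rightarrow> real"
  assumes P: "finite P" "\<And>p. p \<in> P \<Longrightarrow> prime p" "\<And>p. p \<in> P \<Longrightarrow> p \<le> M"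
    and f: "\<And>i. 1 \<le> i \<Longrightarrow> f (Suc i) \<le> f i" "\<And>i. 0 \<le> f i"
  shows "(\<Sum>p\<in>P. ln (real p) * f p) \<le> ln 4 * (\<Sum>i=1..M. f i)"
proof -
  define a where "a = (\<lambda>p::nat. if prime p then ln (real p) else 0)"
  have a: "(\<Sum>p=1..n. a p) = (\<Sum>p | prime p \<and> p \<le> n. ln (real p))" for n
    unfolding a_def by (subst sum.inter_filter[symmetric])
      (auto intro!: sum.cong dest: prime_gt_0_nat simp: Suc_le_eq)
  have "0 \<le> (\<Sum>i=1..M. (ln 4 - a i) * f i)"
    by (rule sum_mult_antimono_nonneg) (use f chebyshev_theta_le a in \<open>auto simp: sum_subtractf mult.commute\<close>)
  then have "(\<Sum>p=1..M. a p * f p) \<le> ln 4 * (\<Sum>i=1..M. f i)"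
    by (simp add: algebra_simps sum_subtractf sum_distrib_left)
  moreover have "(\<Sum>p\<in>P. ln (real p) * f p) = (\<Sum>p\<in>P. a p * f p)"
    using P by (intro sum.cong) (auto simp: a_def)
  moreover have "(\<Sum>p\<in>P. a p * f p) \<le> (\<Sum>p=1..M. a p * f p)"
  proof (rule sum_mono2)
    show "P \<subseteq> {1..M}" using P prime_gt_0_nat by (fastforce simp: Suc_le_eq)
    fix b show "0 \<le> a b * f b" using f prime_gt_0_nat by (auto simp: a_def Suc_le_eq)
  qed simp
  ultimately show ?thesis by linarith
qed

text \<open>Integral comparison on [x - 1, x] through the mean value theorem. One formula serves
  both s < 1, for primes up to a bound, and s > 1, for tails.\<close>

lemma powr_minus_le_diff:
  assumes "s > 0" "s \<noteq> 1" "x > (1::real)"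
  shows "x powr (- s) \<le> (x powr (1 - s) - (x - 1) powr (1 - s)) / (1 - s)"
proof -
  have "\<exists>z>x - 1. z < x \<and> x powr (1 - s) / (1 - s) - (x - 1) powr (1 - s) / (1 - s) = (x - (x - 1)) * z powr (- s)"
  proof (rule MVT2)
    fix t assume "x - 1 \<le> t" "t \<le> x"
    then have "((\<lambda>t. t powr (1 - s)) has_real_derivative (1 - s) * t powr (1 - s - 1)) (at t)"
      using assms by (intro has_real_derivative_powr) auto
    from DERIV_cdivide[OF this, of "1 - s"] assms
    show "((\<lambda>t. t powr (1 - s) / (1 - s)) has_real_derivative t powr (- s)) (at t)" by simp
  qed simp
  then obtain z where z: "z > x - 1" "z < x"
    "x powr (1 - s) / (1 - s) - (x - 1) powr (1 - s) / (1 - s) = z powr (- s)" by auto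
  have "x powr (- s) \<le> z powr (- s)" using z assms by (intro powr_mono2') auto
  then show ?thesis using z by (simp add: diff_divide_distrib)
qed

lemma sum_powr_minus_le:
  assumes "s > 0" "s \<noteq> 1" "1 \<le> m" "m \<le> M"
  shows "(\<Sum>i=Suc m..M. real i powr (- s)) \<le> (real M powr (1 - s) - real m powr (1 - s)) / (1 - s)"
  using assms(4)
proof (induction M rule: dec_induct)
  case base
  then show ?case by simp
next
  case (step n)
  have "real (Suc n) powr (- s) \<le> (real (Suc n) powr (1 - s) - real n powr (1 - s)) / (1 - s)"
    using powr_minus_le_diff[of s "real (Suc n)"] assms step by simp
  then show ?case using step by (simp add: diff_divide_distrib)
qed

lemma sum_inverse_le_ln:
  assumes "1 \<le> M"
  shows "(\<Sum>i=Suc 1..M. 1 / real i) \<le> ln (real M)"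
  using assms
proof (induction M rule: dec_induct)
  case base
  then show ?case by simp
next
  case (step n)
  have "ln (real n / real (Suc n)) \<le> real n / real (Suc n) - 1"
    using step by (intro ln_le_minus_one) auto
  also have "\<dots> = - (1 / real (Suc n))" by (simp add: field_simps)
  finally have "1 / real (Suc n) \<le> ln (real (Suc n)) - ln (real n)"
    using step by (simp add: ln_div)
  then show ?case using step by simp
qed

text \<open>Multiplying each term by ln p / ln z >= 1 reduces to the weighted sum. The saving ln z
  depends on the lower cutoff, which is why the primes up to y are later cut at powers of log
  N.\<close>

lemma sum_primes_powr_upto_le:
  assumes P: "finite P" "\<And>p. p \<in> P \<Longrightarrow> prime p" "\<And>p. p \<in> P \<Longrightarrow> z \<le> real p" "\<And>p. p \<in> P \<Longrightarrow> real p \<le> y"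
    and "0 < s" "s < 1" "1 < z" "1 \<le> y"
  shows "(\<Sum>p\<in>P. real p powr (- s)) \<le> ln 4 * (y powr (1 - s) / ((1 - s) * ln z))"
proof -
  define M where "M = nat \<lfloor>y\<rfloor>"
  have M: "1 \<le> M" "real M \<le> y" using \<open>1 \<le> y\<close> by (auto simp: M_def le_nat_floor)
  have "ln z * (\<Sum>p\<in>P. real p powr (- s)) \<le> (\<Sum>p\<in>P. ln (real p) * real p powr (- s))"
    unfolding sum_distrib_left using P assms by (intro sum_mono mult_right_mono ln_mono) auto
  also have "\<dots> \<le> ln 4 * (\<Sum>i=1..M. real i powr (- s))"
    using P assms by (intro sum_primes_ln_mult_le) (auto simp: M_def le_nat_floor intro!: powr_mono2')
  also have "(\<Sum>i=1..M. real i powr (- s)) = 1 + (\<Sum>i=Suc 1..M. real i powr (- s))"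
    using M by (subst sum.atLeast_Suc_atMost) auto
  also have "(\<Sum>i=Suc 1..M. real i powr (- s)) \<le> (real M powr (1 - s) - 1) / (1 - s)"
    using sum_powr_minus_le[of s 1 M] assms M by simp
  also have "1 + \<dots> \<le> y powr (1 - s) / (1 - s)"
  proof -
    have "real M powr (1 - s) \<le> y powr (1 - s)" using M assms by (intro powr_mono2) auto
    then have "(real M powr (1 - s) - s) / (1 - s) \<le> y powr (1 - s) / (1 - s)"
      using assms by (intro divide_right_mono) auto
    moreover have "1 + (real M powr (1 - s) - 1) / (1 - s) = (real M powr (1 - s) - s) / (1 - s)"
      using assms by (simp add: field_simps)
    ultimately show ?thesis by simp
  qed
  finally have "ln z * (\<Sum>p\<in>P. real p powr (- s)) \<le> ln 4 * (y powr (1 - s) / (1 - s))"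
    by simp
  moreover have "ln z > 0" using assms by simp
  ultimately show ?thesis using assms by (simp add: field_simps)
qed

lemma sum_primes_ln_powr_le:
  assumes P: "finite P" "\<And>p. p \<in> P \<Longrightarrow> prime p" "\<And>p. p \<in> P \<Longrightarrow> y \<le> real p" and "1 < s" "1 \<le> y"
  shows "(\<Sum>p\<in>P. ln (real p) * real p powr (- s)) \<le> ln 4 * (s / (s - 1) * y powr (1 - s))"
proof -
  define m where "m = nat \<lceil>y\<rceil>"
  have m: "1 \<le> m" "y \<le> real m" using \<open>1 \<le> y\<close> by (auto simp: m_def le_nat_iff) 
  obtain M where M: "m \<le> M" "\<And>p. p \<in> P \<Longrightarrow> p \<le> M"
  proof -
    have "p \<le> m + \<Sum>P" if "p \<in> P" for p
      using member_le_sum[of p P "\<lambda>x. x"] P that by simp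
    then show thesis using that[of "m + \<Sum>P"] by simp
  qed
  \<comment> \<open>Freezing the function below m keeps it antitone on all of 1..M. The m frozen
    terms add m^(1 - s), which turns 1 / (s - 1) into s / (s - 1); M itself disappears from the
    final bound.\<close>
  define f where "f = (\<lambda>i. real (max i m) powr (- s))"
  have "(\<Sum>p\<in>P. ln (real p) * real p powr (- s)) = (\<Sum>p\<in>P. ln (real p) * f p)"
  proof (intro sum.cong refl)
    fix p assume "p \<in> P"
    then have "m \<le> p" using P(3)[of p] by (simp add: m_def nat_le_iff ceiling_le_iff)
    then show "ln (real p) * real p powr (- s) = ln (real p) * f p" by (simp add: f_def max_absorb1)
  qed
  also have "\<dots> \<le> ln 4 * (\<Sum>i=1..M. f i)"
    using P M m assms by (intro sum_primes_ln_mult_le) (auto simp: f_def intro!: powr_mono2')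
  also have "(\<Sum>i=1..M. f i) = (\<Sum>i=1..m. f i) + (\<Sum>i=Suc m..M. f i)"
    using M m sum.ub_add_nat[of 1 m f "M - m"] by simp
  also have "(\<Sum>i=1..m. f i) = (\<Sum>i=1..m. real m powr (- s))"
    by (intro sum.cong) (auto simp: f_def max_absorb2)
  also have "\<dots> = real m powr (1 - s)" using m by (simp add: powr_diff powr_minus divide_simps)
  also have "(\<Sum>i=Suc m..M. f i) = (\<Sum>i=Suc m..M. real i powr (- s))"
    by (intro sum.cong) (auto simp: f_def max_absorb1)
  also have "\<dots> \<le> (real M powr (1 - s) - real m powr (1 - s)) / (1 - s)"
    using assms m M by (intro sum_powr_minus_le) auto
  also have "\<dots> = (real m powr (1 - s) - real M powr (1 - s)) / (s - 1)"
    by (metis minus_diff_eq minus_divide_divide)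
  also have "\<dots> \<le> real m powr (1 - s) / (s - 1)"
    using assms by (intro divide_right_mono) auto
  also have "real m powr (1 - s) + real m powr (1 - s) / (s - 1) = s / (s - 1) * real m powr (1 - s)"
    using assms by (simp add: field_simps)
  also have "\<dots> \<le> s / (s - 1) * y powr (1 - s)"
    using assms m by (intro mult_left_mono powr_mono2') auto
  finally show ?thesis by simp
qed

lemma sum_primes_powr_beyond_le:
  assumes P: "finite P" "\<And>p. p \<in> P \<Longrightarrow> prime p" "\<And>p. p \<in> P \<Longrightarrow> y \<le> real p" and "1 < s" "1 < y"
  shows "(\<Sum>p\<in>P. real p powr (- s)) \<le> ln 4 * (s / (s - 1) * (y powr (1 - s) / ln y))"
proof -
  have "ln y * (\<Sum>p\<in>P. real p powr (- s)) \<le> (\<Sum>p\<in>P. ln (real p) * real p powr (- s))"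
    unfolding sum_distrib_left using P assms by (intro sum_mono mult_right_mono ln_mono) auto
  also have "\<dots> \<le> ln 4 * (s / (s - 1) * y powr (1 - s))"
    using P assms by (intro sum_primes_ln_powr_le) auto
  finally show ?thesis using assms by (simp add: field_simps)
qed

section \<open>Exponents up to one half\<close>

text \<open>The difference of the two sides has derivative t (1 - 2 t) / (1 - t), which is
  nonnegative up to t = 1/2.\<close>

lemma neg_ln_one_minus_le:
  assumes "0 \<le> r" "r \<le> 1/2"
  shows "- ln (1 - r) \<le> r + (r::real)\<^sup>2"
proof -
  define f where "f = (\<lambda>r::real. r + r\<^sup>2 + ln (1 - r))"
  have "f 0 \<le> f r"
  proof (rule DERIV_nonneg_imp_nondecreasing[OF assms(1)])
    fix t assume t: "0 \<le> t" "t \<le> r"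
    then have "t < 1" using assms by simp
    then have "(f has_real_derivative (1 + 2 * t - 1 / (1 - t))) (at t)"
      unfolding f_def by (auto intro!: derivative_eq_intros)
    moreover have "0 \<le> 1 + 2 * t - 1 / (1 - t)"
    proof -
      have "0 \<le> t * (1 - 2 * t)" using t assms by simp
      then show ?thesis using \<open>t < 1\<close> by (simp add: field_simps)
    qed
    ultimately show "\<exists>y. (f has_real_derivative y) (at t) \<and> 0 \<le> y" by blast
  qed
  then show ?thesis by (simp add: f_def)
qed

section \<open>Elementary comparisons of GCD sums\<close>

lemma gcd_form_ge_card:
  assumes "finite B" "0 \<notin> B"
  shows "real (card B) \<le> gcd_form \<alpha> B"
proof -
  have "real (card B) = (\<Sum>m\<in>B. 1)" by simp
  also have "\<dots> \<le> gcd_form \<alpha> B"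
    unfolding gcd_form_def
  proof (rule sum_mono)
    fix m assume m: "m \<in> B"
    then have "m > 0" using assms by (metis gr0I)
    then have "1 = real (gcd m m) powr (2 * \<alpha>) / (real m * real m) powr \<alpha>"
      by (simp add: powr_mult flip: powr_add)
    also have "\<dots> \<le> (\<Sum>n\<in>B. real (gcd m n) powr (2 * \<alpha>) / (real m * real n) powr \<alpha>)"
      using assms m by (intro member_le_sum) auto
    finally show "1 \<le> (\<Sum>n\<in>B. real (gcd m n) powr (2 * \<alpha>) / (real m * real n) powr \<alpha>)" .
  qed
  finally show ?thesis .
qed

lemma gcd_quotient_pos:
  assumes "m > 0" "n > 0"
  shows "0 < real (gcd m n) powr (2 * \<alpha>) / (real m * real n) powr \<alpha>"
  using assms by (simp add: gcd_pos_nat)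

lemma gcd_quotient_powr:
  assumes "m > 0" "n > 0"
  shows "real (gcd m n) powr (2 * \<alpha>) / (real m * real n) powr \<alpha> = ((real (gcd m n))\<^sup>2 / (real m * real n)) powr \<alpha>"
  using assms by (simp add: powr_divide flip: powr_powr powr_numeral)

lemma gcd_quotient_le_1:
  assumes "m > 0" "n > 0"
  shows "(real (gcd m n))\<^sup>2 / (real m * real n) \<le> 1"
proof -
  have "real (gcd m n) * real (gcd m n) \<le> real m * real n"
    using assms by (intro mult_mono) (auto intro!: dvd_imp_le)
  then show ?thesis using assms by (simp add: power2_eq_square divide_le_eq)
qed

text \<open>Each term is a power of gcd^2 / (m n), a number in (0, 1].\<close>

lemma gcd_form_antimono:
  assumes "0 \<notin> B" "\<alpha> \<le> \<beta>"
  shows "gcd_form \<beta> B \<le> gcd_form \<alpha> B"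
  unfolding gcd_form_def
proof (intro sum_mono)
  fix m n assume "m \<in> B" "n \<in> B"
  then have pos: "m > 0" "n > 0" using assms(1) by (metis gr0I)+
  show "real (gcd m n) powr (2 * \<beta>) / (real m * real n) powr \<beta> \<le> real (gcd m n) powr (2 * \<alpha>) / (real m * real n) powr \<alpha>"
    unfolding gcd_quotient_powr[OF pos] using gcd_quotient_le_1[OF pos] assms(2) pos
    by (intro powr_mono') auto
qed

lemma gcd_form_le_card_squared:
  assumes "0 \<notin> B" "0 \<le> \<alpha>"
  shows "gcd_form \<alpha> B \<le> (real (card B))\<^sup>2"
proof -
  have "gcd_form \<alpha> B \<le> gcd_form 0 B" using assms by (rule gcd_form_antimono)
  also have "\<dots> \<le> (\<Sum>m\<in>B. \<Sum>n\<in>B. 1)"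
    unfolding gcd_form_def by (intro sum_mono) auto
  also have "\<dots> = (real (card B))\<^sup>2" by (simp add: power2_eq_square)
  finally show ?thesis .
qed

text \<open>Logarithmic form of the moment bound. Dividing by k turns the exponents 2 k and k^2 into
  2 and k. The majorant h is free, and at each prime it has to dominate only one of the two local
  bounds, so every application selects the bound prime by prime.\<close>

lemma ln_gcd_form_le_sum:
  fixes B :: "nat set"
  assumes B: "finite B" "B \<noteq> {}" "0 \<notin> B" and "\<alpha> > 0" "k \<ge> 1"
    and h: "\<And>p. prime p \<Longrightarrow> - 2 * ln (1 - real p powr (- \<alpha>)) \<le> h p \<or> - real k * ln (1 - real p powr (- 2 * \<alpha>)) \<le> h p"
  defines "P \<equiv> \<Union>n\<in>B. prime_factors n"
  shows "ln (gcd_form \<alpha> B / card B) \<le> ln (card B) / k + (\<Sum>p\<in>P. h p)"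
proof -
  have P: "finite P" "\<And>p. p \<in> P \<Longrightarrow> prime p"
    using B by (auto simp: P_def prime_factors_dvd)
  have N: "real (card B) > 0" using B by (simp add: card_gt_0_iff)
  have S: "gcd_form \<alpha> B / card B > 0" using gcd_form_ge_card[OF B(1,3), of \<alpha>] N by simp
  have "(gcd_form \<alpha> B / card B) ^ k \<le> card B *
    (\<Prod>p\<in>P. min ((1 / (1 - real p powr (- \<alpha>))) ^ (2 * k)) ((1 / (1 - real p powr (- 2 * \<alpha>))) ^ k\<^sup>2))"
    unfolding P_def by (rule gcd_form_power_le) fact+
  also have "\<dots> \<le> card B * (\<Prod>p\<in>P. exp (k * h p))"
  proof (intro mult_left_mono prod_mono conjI)
    fix p assume "p \<in> P"
    then have p: "prime p" "real p > 1" using P(2) prime_gt_1_nat[of p] by auto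
    have pow: "(1 / (1 - t)) ^ n = exp (- real n * ln (1 - t))" if "t < 1" for t :: real and n
      using that by (simp add: exp_of_nat_mult exp_minus power_inverse inverse_eq_divide power_one_over)
    have less: "real p powr (- \<alpha>) < 1" "real p powr (- 2 * \<alpha>) < 1"
      using p \<open>\<alpha> > 0\<close> by (auto simp: powr_less_one)
    then show "0 \<le> min ((1 / (1 - real p powr (- \<alpha>))) ^ (2 * k)) ((1 / (1 - real p powr (- 2 * \<alpha>))) ^ k\<^sup>2)"
      by simp
    from h[OF p(1)] show "min ((1 / (1 - real p powr (- \<alpha>))) ^ (2 * k)) ((1 / (1 - real p powr (- 2 * \<alpha>))) ^ k\<^sup>2) \<le> exp (k * h p)"
    proof
      assume "- 2 * ln (1 - real p powr (- \<alpha>)) \<le> h p"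
      then have "real k * (- 2 * ln (1 - real p powr (- \<alpha>))) \<le> k * h p"
        by (intro mult_left_mono) auto
      then have "(1 / (1 - real p powr (- \<alpha>))) ^ (2 * k) \<le> exp (k * h p)"
        by (simp add: pow[OF less(1)] mult_ac)
      then show ?thesis by simp
    next
      assume "- real k * ln (1 - real p powr (- 2 * \<alpha>)) \<le> h p"
      then have "real k * (- real k * ln (1 - real p powr (- 2 * \<alpha>))) \<le> k * h p"
        by (intro mult_left_mono) auto
      then have "(1 / (1 - real p powr (- 2 * \<alpha>))) ^ k\<^sup>2 \<le> exp (k * h p)"
        by (simp only: pow[OF less(2)]) (simp add: power2_eq_square mult_ac)
      then show ?thesis by simp
    qed
  qed simp
  also have "\<dots> = exp (ln (card B) + k * (\<Sum>p\<in>P. h p))"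
    using N P by (simp add: exp_add exp_sum sum_distrib_left)
  finally have "ln ((gcd_form \<alpha> B / card B) ^ k) \<le> ln (exp (ln (card B) + k * (\<Sum>p\<in>P. h p)))"
    using S by (intro ln_mono zero_less_power)
  then have "k * ln (gcd_form \<alpha> B / card B) \<le> ln (card B) + k * (\<Sum>p\<in>P. h p)"
    using S by (simp only: ln_realpow ln_exp)
  then show ?thesis using \<open>k \<ge> 1\<close> by (simp add: field_simps)
qed

text \<open>Jensen for x^(\<beta> / \<alpha>) over all pairs with equal weights, since each term at
  \<beta> is the term at \<alpha> raised to \<beta> / \<alpha>. In logarithms this interpolates
  between the value ln N at exponent 0 and the value at \<beta>.\<close>

lemma ln_gcd_form_interpolate:
  assumes B: "finite B" "B \<noteq> {}" "0 \<notin> B" and "0 < \<alpha>" "\<alpha> \<le> \<beta>"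
  shows "ln (gcd_form \<alpha> B / card B) \<le> ln (card B) - \<alpha> / \<beta> * (ln (card B) - ln (gcd_form \<beta> B / card B))"
proof -
  have N: "real (card B) > 0" using B by (simp add: card_gt_0_iff)
  have S: "gcd_form s B > 0" for s using gcd_form_ge_card[OF B(1,3), of s] N by simp
  define a where "a = (\<lambda>s x. real (gcd (fst x) (snd x)) powr (2 * s) / (real (fst x) * real (snd x)) powr s)"
  have pos: "m > 0" if "m \<in> B" for m using B(3) that by (metis gr0I)
  have form: "gcd_form s B = (\<Sum>x\<in>B \<times> B. a s x)" for s
    by (simp add: gcd_form_def a_def sum.cartesian_product split_def)
  have "(\<Sum>x\<in>B \<times> B. (1 / (real (card B))\<^sup>2) *\<^sub>R a \<alpha> x) powr (\<beta> / \<alpha>) \<le> (\<Sum>x\<in>B \<times> B. 1 / (real (card B))\<^sup>2 * a \<alpha> x powr (\<beta> / \<alpha>))"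
  proof (rule convex_on_sum[where C = "{0<..}"])
    show "convex_on {0<..} (\<lambda>x. x powr (\<beta> / \<alpha>))" using assms by (intro powr_convex) auto
    show "(\<Sum>x\<in>B \<times> B. 1 / (real (card B))\<^sup>2) = 1"
      using N by (simp add: card_cartesian_product power2_eq_square)
    show "a \<alpha> x \<in> {0<..}" if "x \<in> B \<times> B" for x
      unfolding a_def using that gcd_quotient_pos[of "fst x" "snd x" \<alpha>] pos by auto
  qed (use B in auto)
  also have "(\<Sum>x\<in>B \<times> B. (1 / (real (card B))\<^sup>2) *\<^sub>R a \<alpha> x) = gcd_form \<alpha> B / (real (card B))\<^sup>2"
    by (simp add: form sum_divide_distrib)
  also have "(\<Sum>x\<in>B \<times> B. 1 / (real (card B))\<^sup>2 * a \<alpha> x powr (\<beta> / \<alpha>)) = gcd_form \<beta> B / (real (card B))\<^sup>2"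
    unfolding form sum_divide_distrib
  proof (intro sum.cong refl)
    fix x assume "x \<in> B \<times> B"
    then have "a \<alpha> x powr (\<beta> / \<alpha>) = a \<beta> x"
      unfolding a_def using assms pos by (subst (1 2) gcd_quotient_powr) (auto simp: powr_powr)
    then show "1 / (real (card B))\<^sup>2 * a \<alpha> x powr (\<beta> / \<alpha>) = a \<beta> x / (real (card B))\<^sup>2" by simp
  qed
  finally have "ln ((gcd_form \<alpha> B / (real (card B))\<^sup>2) powr (\<beta> / \<alpha>)) \<le> ln (gcd_form \<beta> B / (real (card B))\<^sup>2)"
    using S[of \<alpha>] N by (intro ln_mono) auto
  then have "\<beta> / \<alpha> * ln (gcd_form \<alpha> B / (real (card B))\<^sup>2) \<le> ln (gcd_form \<beta> B / (real (card B))\<^sup>2)"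
    using S[of \<alpha>] N by (simp add: ln_powr)
  then have "ln (gcd_form \<alpha> B / (real (card B))\<^sup>2) \<le> \<alpha> / \<beta> * ln (gcd_form \<beta> B / (real (card B))\<^sup>2)"
    using assms by (simp add: field_simps)
  moreover have "ln (gcd_form s B / (real (card B))\<^sup>2) = ln (gcd_form s B / card B) - ln (card B)" for s
    using S[of s] N by (simp add: ln_div ln_realpow)
  ultimately have "ln (gcd_form \<alpha> B / card B) - ln (card B) \<le> \<alpha> / \<beta> * (ln (gcd_form \<beta> B / card B) - ln (card B))"
    by simp
  then show ?thesis by (simp add: algebra_simps)
qed

text \<open>Halving the distance d to the exponent 1 costs a bounded amount: 1 - p^-d <= d ln p, and
  d times the sum of ln p p^(-1 - d) is at most ln 4 (1 + d) <= 3. Hence growth is linear in j, that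
  is, logarithmic in the inverse distance, without Mertens' theorem.\<close>

lemma sum_primes_powr_near_1_le:
  assumes P: "finite P" "\<And>p. p \<in> P \<Longrightarrow> prime p"
  shows "(\<Sum>p\<in>P. real p powr (- 1 - 1 / 2 ^ j)) \<le> 2 + 3 * real j"
proof -
  have p2: "2 \<le> real p" if "p \<in> P" for p
    using prime_ge_2_nat[OF P(2)[OF that]] by linarith
  show ?thesis
  proof (induction j)
    case 0
    have "(\<Sum>p\<in>P. real p powr (- 2)) \<le> ln 4 * (2 / (2 - 1) * (2 powr (1 - 2) / ln 2))"
      using P p2 by (intro sum_primes_powr_beyond_le) auto
    also have "\<dots> = 2"
      using ln_realpow[of "2::real" 2] by (simp add: powr_minus)
    finally show ?case by simp
  next
    case (Suc j)
    define d where "d = (1::real) / 2 ^ Suc j"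
    have d: "d > 0" "1 / 2 ^ j = 2 * d" by (auto simp: d_def)
    have "(1/2 :: real) ^ Suc j \<le> 1" by (rule power_le_one) auto
    then have "d \<le> 1" by (simp add: d_def power_one_over)
    have "(\<Sum>p\<in>P. real p powr (- 1 - d)) \<le> (\<Sum>p\<in>P. real p powr (- 1 - 2 * d) + d * (ln (real p) * real p powr (- (1 + d))))"
    proof (rule sum_mono)
      fix p assume "p \<in> P"
      then have p: "real p > 0" using P prime_gt_0_nat by auto
      have "real p powr (- d) = exp (- d * ln (real p))" using p by (simp add: powr_def)
      also have "\<dots> \<ge> 1 + (- d * ln (real p))" by (rule exp_ge_add_one_self)
      finally have "real p powr (- (1 + d)) * (1 - d * ln (real p)) \<le> real p powr (- (1 + d)) * real p powr (- d)"
        by (intro mult_left_mono) auto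
      also have "\<dots> = real p powr (- (1 + d) + - d)" by (simp only: powr_add)
      also have "- (1 + d) + - d = - 1 - 2 * d" by simp
      finally show "real p powr (- 1 - d) \<le> real p powr (- 1 - 2 * d) + d * (ln (real p) * real p powr (- (1 + d)))"
        by (simp add: algebra_simps)
    qed
    also have "\<dots> = (\<Sum>p\<in>P. real p powr (- 1 - 2 * d)) + d * (\<Sum>p\<in>P. ln (real p) * real p powr (- (1 + d)))"
      by (simp add: sum.distrib sum_distrib_left)
    also have "d * (\<Sum>p\<in>P. ln (real p) * real p powr (- (1 + d))) \<le> d * (ln 4 * ((1 + d) / ((1 + d) - 1) * 1 powr (1 - (1 + d))))"
      using P d by (intro mult_left_mono sum_primes_ln_powr_le) (auto dest: p2)
    also have "\<dots> = ln 4 * (1 + d)" using d by simp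
    also have "\<dots> \<le> 3"
    proof -
      have "ln (4::real) = 2 * ln 2" using ln_realpow[of "2::real" 2] by simp
      then have "ln 4 \<le> (25/18 :: real)" using ln2_le_25_over_36 by simp
      then have "ln 4 * (1 + d) \<le> 25/18 * 2" using d \<open>d \<le> 1\<close> by (intro mult_mono) auto
      then show ?thesis by simp
    qed
    finally have "(\<Sum>p\<in>P. real p powr (- 1 - d)) \<le> (\<Sum>p\<in>P. real p powr (- 1 - 2 * d)) + 3" by simp
    moreover have "(\<Sum>p\<in>P. real p powr (- 1 - 2 * d)) \<le> 2 + 3 * real j"
      using Suc.IH unfolding d(2) .
    ultimately have "(\<Sum>p\<in>P. real p powr (- 1 - d)) \<le> 2 + 3 * real j + 3" by (meson add_right_mono order.trans)
    then show ?case unfolding d_def [symmetric] by simp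
  qed
qed

text \<open>Both quantities are bounded together because interpolating down from (1 + \<delta>) / 2
  loses \<delta> X in addition to the sum there. The exponent 2 \<beta> = 1 + \<delta> makes the
  prime sum of size log (1 / \<delta>), which is where L enters.\<close>

lemma gcd_form_near_half:
  assumes B: "finite B" "B \<noteq> {}" "0 \<notin> B" and X: "X = ln (card B)" and L: "L = ln X" "L \<ge> 5"
  obtains \<delta> where "0 < \<delta>" "\<delta> * X + ln (gcd_form ((1 + \<delta>) / 2) B / card B) \<le> 15 * sqrt (X * L)"
proof -
  have "X \<ge> 0" using B by (simp add: X Suc_leI card_gt_0_iff)
  then have "X > 0" using L by (cases "X = 0") auto
  have XL: "X \<ge> L" using L \<open>X > 0\<close> ln_le_minus_one[of X] by simp
  \<comment> \<open>Balances the cost X / x of the factor N against the cost x L of the prime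
    sum.\<close>
  define x where "x = sqrt (X / L)"
  have x: "x \<ge> 1" "x \<le> sqrt X" using XL L \<open>X > 0\<close> by (auto simp: x_def divide_simps)
  have xL: "x * L = sqrt (X * L)" "X / x = sqrt (X * L)"
  proof -
    define u v where "u = sqrt X" and "v = sqrt L"
    have "u > 0" "v > 0" "X = u * u" "L = v * v" "x = u / v" "sqrt (X * L) = u * v"
      using L(2) \<open>X > 0\<close> by (auto simp: u_def v_def x_def real_sqrt_divide real_sqrt_mult)
    then show "x * L = sqrt (X * L)" "X / x = sqrt (X * L)" by auto
  qed
  \<comment> \<open>Rounding k up to a power of two loses at most a factor 2 and makes \<delta> = 1
    / k one of the distances reached by repeated halving.\<close>
  define j where "j = nat \<lceil>log 2 x\<rceil>"
  define k where "k = (2::nat) ^ j"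
  have "0 \<le> log 2 x" using x by simp
  then have j: "log 2 x \<le> real j" "real j \<le> 1 + log 2 x" by (auto simp: j_def) linarith+
  have k1: "x \<le> real k"
  proof -
    have "x = 2 powr (log 2 x)" using x by simp
    also have "\<dots> \<le> 2 powr real j" using j by (intro powr_mono) auto
    finally show ?thesis by (simp add: k_def powr_realpow)
  qed
  have k2: "real k \<le> 2 * x"
  proof -
    have "real k = 2 powr real j" by (simp add: k_def powr_realpow)
    also have "\<dots> \<le> 2 powr (1 + log 2 x)" using j by (intro powr_mono) auto
    finally show ?thesis using x by (simp add: powr_add)
  qed
  have jL: "real j \<le> 1 + 3/4 * L"
  proof -
    have "ln x \<le> ln (sqrt X)" using x by (intro ln_mono) auto
    also have "\<dots> = L / 2" using L \<open>X > 0\<close> by (simp add: ln_sqrt)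
    finally have "log 2 x \<le> (L / 2) / ln 2" unfolding log_def by (intro divide_right_mono) auto
    also have "\<dots> \<le> (L / 2) / (2/3)"
      using L ln2_ge_two_thirds by (intro divide_left_mono) auto
    finally show ?thesis using j by simp
  qed
  define \<delta> where "\<delta> = (1::real) / 2 ^ j"
  have \<delta>: "\<delta> > 0" "\<delta> = 1 / k" by (auto simp: \<delta>_def k_def)
  define P where "P = (\<Union>n\<in>B. prime_factors n)"
  have P: "finite P" "\<And>p. p \<in> P \<Longrightarrow> prime p"
    using B by (auto simp: P_def prime_factors_dvd)
  define \<beta> where "\<beta> = (1 + \<delta>) / 2"
  have "ln (gcd_form \<beta> B / card B) \<le> ln (card B) / k + (\<Sum>p\<in>P. 2 * real k * real p powr (- 1 - \<delta>))"
    unfolding P_def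
  proof (rule ln_gcd_form_le_sum[OF B], goal_cases)
    case (3 p)
    define s where "s = real p powr (- 1 - \<delta>)"
    have "real p \<ge> 2" using 3 prime_ge_2_nat by fastforce
    then have "s \<le> 2 powr (- 1 - \<delta>)" unfolding s_def using \<delta>(1) by (intro powr_mono2') auto
    also have "\<dots> \<le> 2 powr (- 1)" using \<delta>(1) by (intro powr_mono) auto
    finally have s: "0 \<le> s" "s \<le> 1/2" by (auto simp: s_def powr_minus)
    have "- ln (1 - s) \<le> s + s\<^sup>2" using s by (rule neg_ln_one_minus_le)
    also have "s\<^sup>2 \<le> s" using s by (simp add: power2_eq_square mult_left_le)
    finally have "real k * (- ln (1 - s)) \<le> real k * (2 * s)" by (intro mult_left_mono) auto
    moreover have "- 2 * \<beta> = - 1 - \<delta>" by (simp add: \<beta>_def field_simps)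
    ultimately show ?case by (simp add: s_def)
  qed (use \<delta>(1) in \<open>auto simp: \<beta>_def k_def\<close>)
  also have "(\<Sum>p\<in>P. 2 * real k * real p powr (- 1 - \<delta>)) = 2 * real k * (\<Sum>p\<in>P. real p powr (- 1 - \<delta>))"
    by (simp add: sum_distrib_left)
  also have "\<dots> \<le> 2 * (2 * x) * (2 + 3 * (1 + 3/4 * L))"
    using k2 jL x sum_primes_powr_near_1_le[OF P, of j]
    by (intro mult_mono) (auto simp: \<delta>_def intro!: sum_nonneg)
  also have "\<dots> = 20 * x + 9 * (x * L)" by (simp add: algebra_simps)
  also have "20 * x \<le> 4 * (x * L)" using L x by simp
  also have "4 * (x * L) + 9 * (x * L) = 13 * sqrt (X * L)" using xL by simp
  also have "ln (card B) / k \<le> sqrt (X * L)"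
  proof -
    have "X / k \<le> X / x" using k1 x \<open>X > 0\<close> by (intro divide_left_mono) auto
    then show ?thesis using xL X by simp
  qed
  finally have "ln (gcd_form \<beta> B / card B) \<le> sqrt (X * L) + 13 * sqrt (X * L)" by simp
  moreover have "\<delta> * X \<le> sqrt (X * L)"
  proof -
    have "X / k \<le> X / x" using k1 x \<open>X > 0\<close> by (intro divide_left_mono) auto
    then show ?thesis using xL \<delta> by simp
  qed
  ultimately have "\<delta> * X + ln (gcd_form \<beta> B / card B) \<le> 15 * sqrt (X * L)" by linarith
  then show thesis by (intro that[OF \<delta>(1)]) (simp only: \<beta>_def)
qed

text \<open>Interpolation with 1 / (1 + \<delta>) >= 1 - \<delta> leaves the error 2 \<alpha>
  (\<delta> X + s), where s is the logarithm at (1 + \<delta>) / 2. The factor \<alpha> in the error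
  term thus comes from the interpolation, and 30 from twice 15.\<close>

lemma ln_gcd_form_le_below_half:
  assumes B: "finite B" "B \<noteq> {}" "0 \<notin> B" and X: "X = ln (card B)" and L: "L = ln X" "L \<ge> 5"
    and "0 < \<alpha>" "\<alpha> \<le> 1/2"
  shows "ln (gcd_form \<alpha> B / card B) \<le> 30 * \<alpha> * sqrt (X * L) + (1 - 2 * \<alpha>) * X"
proof -
  obtain \<delta> where \<delta>: "0 < \<delta>" "\<delta> * X + ln (gcd_form ((1 + \<delta>) / 2) B / card B) \<le> 15 * sqrt (X * L)"
    using gcd_form_near_half[OF B X L] .
  define s where "s = ln (gcd_form ((1 + \<delta>) / 2) B / card B)"
  have N: "real (card B) > 0" using B by (simp add: card_gt_0_iff)
  have S: "1 \<le> gcd_form ((1 + \<delta>) / 2) B / card B" "gcd_form ((1 + \<delta>) / 2) B / card B \<le> card B"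
    using gcd_form_ge_card[OF B(1,3), of "(1 + \<delta>) / 2"] gcd_form_le_card_squared[OF B(3), of "(1 + \<delta>) / 2"] N \<delta>
    by (auto simp: divide_simps power2_eq_square)
  then have s: "0 \<le> s" "s \<le> X" unfolding s_def X by (auto intro!: ln_mono)
  have "ln (gcd_form \<alpha> B / card B) \<le> X - \<alpha> / ((1 + \<delta>) / 2) * (X - s)"
    unfolding X s_def using assms \<delta> by (intro ln_gcd_form_interpolate) auto
  also have "\<dots> \<le> X - \<alpha> * (2 - 2 * \<delta>) * (X - s)"
  proof -
    have "(2 - 2 * \<delta>) * (1 + \<delta>) \<le> 2" by (simp add: algebra_simps)
    then have "2 - 2 * \<delta> \<le> 1 / ((1 + \<delta>) / 2)" using \<delta> by (simp add: pos_le_divide_eq)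
    then have "\<alpha> * (2 - 2 * \<delta>) * (X - s) \<le> \<alpha> * (1 / ((1 + \<delta>) / 2)) * (X - s)"
      using assms s by (intro mult_right_mono mult_left_mono) auto
    then show ?thesis by simp
  qed
  also have "\<dots> \<le> (1 - 2 * \<alpha>) * X + 2 * \<alpha> * (\<delta> * X + s)"
  proof -
    have "0 \<le> \<alpha> * \<delta> * s" using assms \<delta> s by simp
    then show ?thesis by (simp add: algebra_simps)
  qed
  also have "\<dots> \<le> (1 - 2 * \<alpha>) * X + 2 * \<alpha> * (15 * sqrt (X * L))"
    using \<delta> assms by (intro add_left_mono mult_left_mono) (auto simp: s_def)
  finally show ?thesis by simp
qed

section \<open>Exponents above one half\<close>

lemma sum_if_eq_filter:
  fixes f :: "'a \<Rightarrow> real"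
  assumes "finite A"
  shows "(\<Sum>x\<in>A. if c x then f x else 0) = (\<Sum>x | x \<in> A \<and> c x. f x)"
  using assms by (simp add: sum.If_cases Int_def)

text \<open>For the smallest primes a sum over all integers from 2 on is affordable. Starting at 2
  produces the -1, without which the first bound would be too large when z^(1 - \<alpha>) is close
  to 1.\<close>

lemma sum_integers_upto_le:
  assumes P: "finite P" "\<And>p. p \<in> P \<Longrightarrow> 2 \<le> p" "\<And>p. p \<in> P \<Longrightarrow> real p \<le> z" and "1 \<le> z" "1/2 < \<alpha>" "\<alpha> < 1"
  shows "(\<Sum>p\<in>P. real p powr (- \<alpha>)) \<le> (z powr (1 - \<alpha>) - 1) / (1 - \<alpha>)"
    and "(\<Sum>p\<in>P. real p powr (- 2 * \<alpha>)) \<le> ln z"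
proof -
  define M where "M = nat \<lfloor>z\<rfloor>"
  have M: "1 \<le> M" "real M \<le> z" using \<open>1 \<le> z\<close> by (auto simp: M_def le_nat_floor)
  have sub: "P \<subseteq> {Suc 1..M}" using P by (force simp: M_def le_nat_floor)
  have "(\<Sum>p\<in>P. real p powr (- \<alpha>)) \<le> (\<Sum>p=Suc 1..M. real p powr (- \<alpha>))"
    using sub by (intro sum_mono2) auto
  also have "\<dots> \<le> (real M powr (1 - \<alpha>) - real 1 powr (1 - \<alpha>)) / (1 - \<alpha>)"
    using M assms by (intro sum_powr_minus_le) auto
  also have "\<dots> \<le> (z powr (1 - \<alpha>) - 1) / (1 - \<alpha>)"
    using M assms by (intro divide_right_mono diff_mono powr_mono2) auto
  finally show "(\<Sum>p\<in>P. real p powr (- \<alpha>)) \<le> (z powr (1 - \<alpha>) - 1) / (1 - \<alpha>)" .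
  have "(\<Sum>p\<in>P. real p powr (- 2 * \<alpha>)) \<le> (\<Sum>p=Suc 1..M. real p powr (- 2 * \<alpha>))"
    using sub by (intro sum_mono2) auto
  also have "\<dots> \<le> (\<Sum>p=Suc 1..M. 1 / real p)"
  proof (rule sum_mono)
    fix p assume "p \<in> {Suc 1..M}"
    then have "real p powr (- 2 * \<alpha>) \<le> real p powr (- 1)" using assms by (intro powr_mono) auto
    then show "real p powr (- 2 * \<alpha>) \<le> 1 / real p" by (simp add: powr_minus_divide)
  qed
  also have "\<dots> \<le> ln (real M)" using M by (intro sum_inverse_le_ln)
  also have "\<dots> \<le> ln z" using M by (intro ln_mono) auto
  finally show "(\<Sum>p\<in>P. real p powr (- 2 * \<alpha>)) \<le> ln z" .
qed

text \<open>Applied with w = X^((1 - \<alpha>) / 4), so that w^2 is the power of log N in the second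
  term of \<open>g\<close>. The logarithm is replaced by its tangent at 2, and the remaining
  quadratic is positive. The coefficient 9/10 leaves 1/10 for the next range of primes.\<close>

lemma small_primes_budget:
  assumes "w > (0::real)"
  shows "2 * (w - 1) + 2 * ln w \<le> 9/10 * w\<^sup>2"
proof -
  have "ln (w / 2) \<le> w / 2 - 1" using assms by (intro ln_le_minus_one) auto
  then have "ln w \<le> w / 2 - 1 + ln 2" using assms by (simp add: ln_div)
  also have "ln 2 \<le> (7/10 :: real)" using ln2_le_25_over_36 by simp
  finally have "2 * (w - 1) + 2 * ln w \<le> 3 * w - 26/10" by simp
  also have "\<dots> \<le> 9/10 * w\<^sup>2"
  proof -
    have "0 \<le> 9/10 * (w - 5/3)\<^sup>2" by simp
    then show ?thesis by (simp add: power2_eq_square algebra_simps)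
  qed
  finally show ?thesis .
qed

text \<open>For \<open>p = 2\<close> and \<open>p = 3\<close> the number \<open>p powr - \<alpha>\<close> may exceed \<open>1/2\<close>, so that
  \<open>neg_ln_one_minus_le\<close> does not apply; these two primes go into the constant \<open>C\<close>.\<close>

definition small_prime_const :: real where
  "small_prime_const = - 2 * ln (1 - 2 powr (- 1/2))"

lemma small_prime_const_nonneg: "small_prime_const \<ge> 0"
proof -
  have "(2::real) powr (- 1/2) < 1" by (rule powr_less_one) auto
  moreover have "(2::real) powr (- 1/2) > 0" by simp
  ultimately have "ln (1 - (2::real) powr (- 1/2)) \<le> 0" by (subst ln_le_zero_iff) linarith+
  then show ?thesis by (simp add: small_prime_const_def)
qed

lemma ln4_le: "ln 4 \<le> (25/18 :: real)"
  using ln_realpow[of "2::real" 2] ln2_le_25_over_36 by simp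

text \<open>With \<eta> = 1 - \<alpha> and \<delta> = 2 \<alpha> - 1 the budget is as follows.
  Multiples of T / sqrt \<delta>: 2 from the factor N and 25/6 from the tail, together below 8.
  Multiple of T / \<eta>: 24/5 ln 4 <= 8 from the primes between X^(1/2) and y. Multiples of
  X^(\<eta> / 2) / \<eta>: 9/10 and 1/10 from the two lower ranges. The primes 2 and 3 give the
  constant.\<close>

lemma ln_gcd_form_le_above_half:
  assumes B: "finite B" "B \<noteq> {}" "0 \<notin> B" and X: "X = ln (card B)" and L: "L = ln X" "L \<ge> 10000"
    and \<alpha>: "1/2 < \<alpha>" "\<alpha> < 1" and large: "1 / sqrt X \<le> 2 * \<alpha> - 1"
  shows "ln (gcd_form \<alpha> B / card B) \<le>
    (8 / (1 - \<alpha>) + 8 / sqrt (2 * \<alpha> - 1)) * X powr (1 - \<alpha>) * L powr (- \<alpha>) + 1 / (1 - \<alpha>) * X powr ((1 - \<alpha>) / 2)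
      + 2 * small_prime_const"
proof -
  have "X \<ge> 0" using B by (simp add: X Suc_leI card_gt_0_iff)
  then have "X > 0" using L by (cases "X = 0") auto
  have X_exp: "X = exp L" using L \<open>X > 0\<close> by simp
  have X4: "X powr (1/4) = exp (L / 4)" using \<open>X > 0\<close> L by (simp add: powr_def)
  have X4_ge: "X powr (1/4) \<ge> 625"
    unfolding X4 using L exp_ge_add_one_self[of "L/4"] by linarith
  have X2: "X powr (1/2) = (X powr (1/4))\<^sup>2" using \<open>X > 0\<close> by (simp add: power2_eq_square flip: powr_add)
  have X_ge_1: "X \<ge> 1" unfolding X_exp using L(2) by (simp only: one_le_exp_iff)
  define \<eta> where "\<eta> = 1 - \<alpha>"
  define \<delta> where "\<delta> = 2 * \<alpha> - 1"
  have \<eta>: "\<eta> > 0" "\<eta> < 1/2" and \<delta>: "\<delta> > 0" "\<delta> < 1" using \<alpha> by (auto simp: \<eta>_def \<delta>_def)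
  define y where "y = X * L"
  have "1 * L \<le> y" "X * 1 \<le> y"
    unfolding y_def using L(2) X_ge_1 by (intro mult_right_mono mult_left_mono; linarith)+
  then have y: "y \<ge> X" "y > 1" using L(2) by linarith+
  have lny: "ln y \<ge> L" using y \<open>X > 0\<close> unfolding L(1) by (intro ln_mono) auto
  define T where "T = X powr \<eta> * L powr (- \<alpha>)"
  have "L > 0" using L(2) by simp
  have T: "y powr \<eta> / L = T" "T \<ge> 0" "X / y powr \<alpha> = T"
  proof -
    have "L powr \<eta> = L powr (1 + - \<alpha>)" by (simp add: \<eta>_def)
    also have "\<dots> = L * L powr (- \<alpha>)" using \<open>L > 0\<close> by (subst powr_add) simp
    finally have "L powr \<eta> = L * L powr (- \<alpha>)" .
    then show "y powr \<eta> / L = T" using \<open>L > 0\<close> by (simp add: y_def powr_mult T_def)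
    have "X = X powr \<eta> * X powr \<alpha>" using \<open>X > 0\<close> by (simp add: \<eta>_def flip: powr_add)
    then have "X / y powr \<alpha> = (X powr \<eta> * X powr \<alpha>) / (X powr \<alpha> * L powr \<alpha>)"
      by (simp add: y_def powr_mult)
    also have "\<dots> = T" using \<open>X > 0\<close> by (simp add: T_def powr_minus_divide)
    finally show "X / y powr \<alpha> = T" .
  qed (simp add: T_def)
  define \<kappa> where "\<kappa> = sqrt \<delta> * y powr \<alpha> / 2"
  \<comment> \<open>The hypothesis on \<alpha> gives sqrt \<delta> >= X^(-1/4), and y^\<alpha> >=
    X^(1/2), so \<kappa> >= X^(1/4) / 2. Rounding \<kappa> up to an integer then at most doubles
    it.\<close>
  have "\<kappa> \<ge> 1"
  proof -
    have "1 / sqrt X \<le> \<delta>" using large by (simp add: \<delta>_def)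
    then have "sqrt (1 / sqrt X) \<le> sqrt \<delta>" by (rule real_sqrt_le_mono)
    moreover have "sqrt (1 / sqrt X) = 1 / X powr (1/4)"
      using \<open>X > 0\<close> by (simp add: real_sqrt_divide powr_half_sqrt[symmetric] powr_powr)
    ultimately have "1 / X powr (1/4) \<le> sqrt \<delta>" by simp
    moreover have "X powr (1/2) \<le> y powr \<alpha>"
    proof -
      have "X powr (1/2) \<le> X powr \<alpha>" using X_ge_1 \<alpha> by (intro powr_mono) auto
      also have "\<dots> \<le> y powr \<alpha>" using y \<open>X > 0\<close> \<alpha> by (intro powr_mono2) auto
      finally show ?thesis .
    qed
    ultimately have "1 / X powr (1/4) * X powr (1/2) \<le> sqrt \<delta> * y powr \<alpha>"
      using \<delta> by (intro mult_mono) auto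
    then have "X powr (1/4) \<le> sqrt \<delta> * y powr \<alpha>"
      using X4_ge \<open>X > 0\<close> by (simp add: X2 power2_eq_square)
    then show ?thesis using X4_ge by (simp add: \<kappa>_def)
  qed
  define k where "k = nat \<lceil>\<kappa>\<rceil>"
  have k: "\<kappa> \<le> real k" "real k \<le> 2 * \<kappa>" "k \<ge> 1" using \<open>\<kappa> \<ge> 1\<close> unfolding k_def by linarith+
  define P where "P = (\<Union>n\<in>B. prime_factors n)"
  have P: "finite P" "\<And>p. p \<in> P \<Longrightarrow> prime p"
    using B by (auto simp: P_def prime_factors_dvd)
  have p2: "2 \<le> real p" if "prime p" for p
    using prime_ge_2_nat[OF that] by linarith
  define r where "r = (\<lambda>p::nat. real p powr (- \<alpha>))"
  have r_sq: "(r p)\<^sup>2 = real p powr (- 2 * \<alpha>)" for p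
    by (simp add: r_def power2_eq_square flip: powr_add)
  have r_mono: "r p \<le> t powr (- \<alpha>)" if "t \<le> real p" "t > 0" for p t
    unfolding r_def using that \<alpha> by (intro powr_mono2') auto
  have r_nonneg: "0 \<le> r p" for p by (simp add: r_def)
  have r_le_half: "r p \<le> 1/2" if "5 \<le> p" for p
  proof -
    have "r p \<le> 4 powr (- \<alpha>)" using that by (intro r_mono) auto
    also have "\<dots> \<le> 4 powr (- (1/2))" using \<alpha> by (intro powr_mono) auto
    also have "\<dots> = 1/2" by (simp add: powr_minus powr_half_sqrt)
    finally show ?thesis .
  qed
  define z where "z = X powr (1/4)"
  \<comment> \<open>Coefficients come from -2 ln (1 - r) <= 2 r + 2 r^2: 3 for r <= 1/2 and 12/5 for
    r <= 1/5. The cut at X^(1/2) keeps the logarithmic saving at L / 2 in the dominant range up to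
    y; with only L / 4 the constant 8 would be exceeded. Overlaps of the ranges are harmless since
    all summands are nonnegative.\<close>
  define f1 f2 f3 f4 f5 where
    "f1 = (\<lambda>p::nat. if p \<in> {2, 3} then small_prime_const else 0)" and
    "f2 = (\<lambda>p::nat. if real p \<le> z then 2 * r p + 2 * real p powr (- 2 * \<alpha>) else 0)" and
    "f3 = (\<lambda>p::nat. if z \<le> real p \<and> real p \<le> X powr (1/2) then 3 * r p else 0)" and
    "f4 = (\<lambda>p::nat. if X powr (1/2) \<le> real p \<and> real p \<le> y then 12/5 * r p else 0)" and
    "f5 = (\<lambda>p::nat. if y \<le> real p then 3/2 * real k * real p powr (- 2 * \<alpha>) else 0)"
  have nonneg: "0 \<le> f1 p" "0 \<le> f2 p" "0 \<le> f3 p" "0 \<le> f4 p" "0 \<le> f5 p" for p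
    using small_prime_const_nonneg r_nonneg by (auto simp: f1_def f2_def f3_def f4_def f5_def)

  have "ln (gcd_form \<alpha> B / card B) \<le> ln (card B) / k + (\<Sum>p\<in>P. f1 p + f2 p + f3 p + f4 p + f5 p)"
    unfolding P_def
  proof (rule ln_gcd_form_le_sum[OF B])
    fix p :: nat assume "prime p"
    note p = p2[OF this]
    consider "p = 2 \<or> p = 3" | "5 \<le> p" "real p \<le> z" | "5 \<le> p" "z \<le> real p" "real p \<le> X powr (1/2)"
      | "X powr (1/2) \<le> real p" "real p \<le> y" | "y \<le> real p"
    proof -
      have "p \<noteq> 4" using prime_odd_nat[OF \<open>prime p\<close>] by auto
      then have "p = 2 \<or> p = 3 \<or> 5 \<le> p" using p by linarith
      then show thesis using that by linarith
    qed
    then show "- 2 * ln (1 - real p powr (- \<alpha>)) \<le> f1 p + f2 p + f3 p + f4 p + f5 p \<or>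
      - real k * ln (1 - real p powr (- 2 * \<alpha>)) \<le> f1 p + f2 p + f3 p + f4 p + f5 p"
    proof cases
      case 1
      have "r p \<le> 2 powr (- \<alpha>)" using p by (intro r_mono) auto
      also have "\<dots> \<le> 2 powr (- 1/2)" using \<alpha> by (intro powr_mono) auto
      finally have "ln (1 - 2 powr (- 1/2)) \<le> ln (1 - r p)"
        by (intro ln_mono) (auto simp: powr_less_one)
      then have "- 2 * ln (1 - r p) \<le> f1 p" using 1 by (auto simp: f1_def small_prime_const_def)
      then show ?thesis using nonneg[of p] unfolding r_def by linarith
    next
      case 2
      then have r: "r p \<le> 1/2" using r_le_half by simp
      have "- 2 * ln (1 - r p) \<le> f2 p"
        using neg_ln_one_minus_le[OF r_nonneg r] 2 r_sq[of p] by (simp add: f2_def)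
      then show ?thesis using nonneg[of p] unfolding r_def by linarith
    next
      case 3
      then have r: "r p \<le> 1/2" using r_le_half by simp
      have "(r p)\<^sup>2 \<le> 1/2 * r p"
        using r r_nonneg[of p] unfolding power2_eq_square by (intro mult_right_mono) auto
      then have "- 2 * ln (1 - r p) \<le> f3 p"
        using neg_ln_one_minus_le[OF r_nonneg r] 3 by (simp add: f3_def)
      then show ?thesis using nonneg[of p] unfolding r_def by linarith
    next
      case 4
      have r: "r p \<le> 1/5"
      proof -
        have "r p \<le> (X powr (1/2)) powr (- \<alpha>)" using 4 \<open>X > 0\<close> by (intro r_mono) auto
        also have "\<dots> \<le> (X powr (1/2)) powr (- 1/2)"
          using X_ge_1 \<alpha> by (intro powr_mono ge_one_powr_ge_zero) auto
        also have "\<dots> = 1 / X powr (1/4)" by (simp add: powr_powr powr_minus_divide)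
        also have "\<dots> \<le> 1 / 5" using X4_ge by (intro divide_left_mono) auto
        finally show ?thesis .
      qed
      then have "(r p)\<^sup>2 \<le> 1/5 * r p"
        using r_nonneg[of p] unfolding power2_eq_square by (intro mult_right_mono) auto
      then have "- 2 * ln (1 - r p) \<le> f4 p"
        using neg_ln_one_minus_le[OF r_nonneg, of p] r 4 by (simp add: f4_def)
      then show ?thesis using nonneg[of p] unfolding r_def by linarith
    next
      case 5
      define s where "s = real p powr (- 2 * \<alpha>)"
      have "s \<le> real p powr (- 1)" unfolding s_def using p \<alpha> by (intro powr_mono) auto
      also have "\<dots> \<le> 1/2" using p by (simp add: powr_minus_divide)
      finally have s: "0 \<le> s" "s \<le> 1/2" by (auto simp: s_def)
      have "s\<^sup>2 \<le> 1/2 * s" using s unfolding power2_eq_square by (intro mult_right_mono) auto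
      then have "- ln (1 - s) \<le> 3/2 * s" using neg_ln_one_minus_le[OF s] by simp
      then have "real k * (- ln (1 - s)) \<le> real k * (3/2 * s)" by (intro mult_left_mono) auto
      then have "- real k * ln (1 - s) \<le> f5 p" using 5 by (simp add: f5_def s_def)
      then show ?thesis using nonneg[of p] unfolding s_def by linarith
    qed
  qed (use \<alpha> k in auto)
  also have "\<dots> = X / k + (\<Sum>p\<in>P. f1 p) + (\<Sum>p\<in>P. f2 p) + (\<Sum>p\<in>P. f3 p) + (\<Sum>p\<in>P. f4 p) + (\<Sum>p\<in>P. f5 p)"
    by (simp add: sum.distrib X)
  also have "(\<Sum>p\<in>P. f1 p) \<le> 2 * small_prime_const"
  proof -
    have "(\<Sum>p\<in>P. f1 p) = (\<Sum>p | p \<in> P \<and> p \<in> {2, 3}. small_prime_const)"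
      unfolding f1_def by (rule sum_if_eq_filter[OF P(1)])
    also have "\<dots> \<le> (\<Sum>p\<in>{2, 3::nat}. small_prime_const)"
      using small_prime_const_nonneg by (intro sum_mono2) auto
    finally show ?thesis by simp
  qed
  also have "(\<Sum>p\<in>P. f2 p) \<le> 2 * ((z powr \<eta> - 1) / \<eta>) + 2 * ln z"
  proof -
    let ?P = "{p. p \<in> P \<and> real p \<le> z}"
    have "(\<Sum>p\<in>P. f2 p) = (\<Sum>p\<in>?P. 2 * r p + 2 * real p powr (- 2 * \<alpha>))"
      unfolding f2_def by (rule sum_if_eq_filter[OF P(1)])
    also have "\<dots> = 2 * (\<Sum>p\<in>?P. real p powr (- \<alpha>)) + 2 * (\<Sum>p\<in>?P. real p powr (- 2 * \<alpha>))"
      by (simp add: sum.distrib sum_distrib_left r_def)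
    also have "\<dots> \<le> 2 * ((z powr \<eta> - 1) / \<eta>) + 2 * ln z"
      unfolding \<eta>_def using P \<alpha> X4_ge prime_ge_2_nat
      by (intro add_mono mult_left_mono sum_integers_upto_le) (auto simp: z_def)
    finally show ?thesis .
  qed
  also have "(\<Sum>p\<in>P. f3 p) \<le> 3 * (ln 4 * ((X powr (1/2)) powr \<eta> / (\<eta> * (L / 4))))"
  proof -
    let ?P = "{p. p \<in> P \<and> z \<le> real p \<and> real p \<le> X powr (1/2)}"
    have "(\<Sum>p\<in>P. f3 p) = (\<Sum>p\<in>?P. 3 * r p)"
      unfolding f3_def by (rule sum_if_eq_filter[OF P(1)])
    also have "\<dots> = 3 * (\<Sum>p\<in>?P. real p powr (- \<alpha>))" by (simp add: sum_distrib_left r_def)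
    also have "(\<Sum>p\<in>?P. real p powr (- \<alpha>)) \<le> ln 4 * ((X powr (1/2)) powr (1 - \<alpha>) / ((1 - \<alpha>) * ln z))"
      using P \<alpha> X4_ge X_ge_1 by (intro sum_primes_powr_upto_le) (auto simp: z_def ge_one_powr_ge_zero)
    also have "ln z = L / 4" using \<open>X > 0\<close> L by (simp add: z_def)
    finally show ?thesis by (simp add: \<eta>_def)
  qed
  also have "(\<Sum>p\<in>P. f4 p) \<le> 12/5 * (ln 4 * (y powr \<eta> / (\<eta> * (L / 2))))"
  proof -
    let ?P = "{p. p \<in> P \<and> X powr (1/2) \<le> real p \<and> real p \<le> y}"
    have "X powr (1/2) > 1" using X4_ge unfolding X2 by (intro one_less_power) auto
    have "(\<Sum>p\<in>P. f4 p) = (\<Sum>p\<in>?P. 12/5 * r p)"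
      unfolding f4_def by (rule sum_if_eq_filter[OF P(1)])
    also have "\<dots> = 12/5 * (\<Sum>p\<in>?P. real p powr (- \<alpha>))" by (simp add: sum_distrib_left r_def)
    also have "(\<Sum>p\<in>?P. real p powr (- \<alpha>)) \<le> ln 4 * (y powr (1 - \<alpha>) / ((1 - \<alpha>) * ln (X powr (1/2))))"
      using P \<alpha> y \<open>X powr (1/2) > 1\<close> by (intro sum_primes_powr_upto_le) auto
    also have "ln (X powr (1/2)) = L / 2" using \<open>X > 0\<close> L by simp
    finally show ?thesis by (simp add: \<eta>_def)
  qed
  also have "(\<Sum>p\<in>P. f5 p) \<le> 25/6 * (T / sqrt \<delta>)"
  proof -
    let ?P = "{p. p \<in> P \<and> y \<le> real p}"
    have "(\<Sum>p\<in>P. f5 p) = (\<Sum>p\<in>?P. 3/2 * real k * real p powr (- 2 * \<alpha>))"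
      unfolding f5_def by (rule sum_if_eq_filter[OF P(1)])
    also have "\<dots> = 3/2 * real k * (\<Sum>p\<in>?P. real p powr (- (2 * \<alpha>)))" by (simp add: sum_distrib_left)
    also have "\<dots> \<le> 3/2 * (2 * \<kappa>) * (ln 4 * (2 * \<alpha> / (2 * \<alpha> - 1) * (y powr (1 - 2 * \<alpha>) / ln y)))"
      using P \<alpha> y k by (intro mult_mono sum_primes_powr_beyond_le) (auto intro!: sum_nonneg)
    also have "\<dots> \<le> 3/2 * (2 * \<kappa>) * (25/18 * (2 / \<delta> * (y powr (- \<delta>) / L)))"
      using \<open>\<kappa> \<ge> 1\<close> ln4_le \<alpha> \<delta> L lny y
      by (intro mult_mono mult_nonneg_nonneg divide_nonneg_nonneg frac_le) (auto simp: \<delta>_def)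
    also have "\<dots> = 25/6 * (sqrt \<delta> / \<delta> * (y powr \<alpha> * y powr (- \<delta>) / L))"
      by (simp add: \<kappa>_def)
    also have "sqrt \<delta> / \<delta> = 1 / sqrt \<delta>" using \<delta> by (simp add: real_div_sqrt field_simps)
    also have "y powr \<alpha> * y powr (- \<delta>) = y powr \<eta>"
      by (simp add: \<eta>_def \<delta>_def flip: powr_add)
    finally show ?thesis using T by simp
  qed
  also have "X / real k \<le> 2 * (T / sqrt \<delta>)"
  proof -
    have "X / real k \<le> X / \<kappa>" using k \<open>\<kappa> \<ge> 1\<close> \<open>X > 0\<close> by (intro divide_left_mono) auto
    also have "\<dots> = 2 * (X / y powr \<alpha> / sqrt \<delta>)" by (simp add: \<kappa>_def mult_ac)
    also have "X / y powr \<alpha> = T" by (rule T(3))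
    finally show ?thesis .
  qed
  also have "12/5 * (ln 4 * (y powr \<eta> / (\<eta> * (L / 2)))) \<le> 8 * (T / \<eta>)"
  proof -
    have "12/5 * (ln 4 * (y powr \<eta> / (\<eta> * (L / 2)))) = 24/5 * ln 4 * (T / \<eta>)"
      by (simp add: mult_ac flip: T(1))
    also have "\<dots> \<le> 8 * (T / \<eta>)" using T \<eta> ln4_le by (intro mult_right_mono) auto
    finally show ?thesis .
  qed
  \<comment> \<open>Primes up to X^(1/2) only contribute the power X^(\<eta> / 2), so the saving 1 /
    L absorbs the constant 12 ln 4.\<close>
  also have "3 * (ln 4 * ((X powr (1/2)) powr \<eta> / (\<eta> * (L / 4)))) \<le> 1/10 * (X powr (\<eta> / 2) / \<eta>)"
  proof -
    have "3 * (ln 4 * ((X powr (1/2)) powr \<eta> / (\<eta> * (L / 4)))) = (12 * ln 4 / L) * (X powr (\<eta> / 2) / \<eta>)"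
      by (simp add: powr_powr mult_ac)
    also have "\<dots> \<le> 1/10 * (X powr (\<eta> / 2) / \<eta>)"
      using \<eta> ln4_le L by (intro mult_right_mono) (auto simp: field_simps)
    finally show ?thesis .
  qed
  also have "2 * ((z powr \<eta> - 1) / \<eta>) + 2 * ln z \<le> 9/10 * (X powr (\<eta> / 2) / \<eta>)"
  proof -
    define w where "w = z powr \<eta>"
    have w: "w > 0" "w\<^sup>2 = X powr (\<eta> / 2)" "ln w = \<eta> * ln z"
      using \<open>X > 0\<close> by (auto simp: w_def z_def powr_powr power2_eq_square simp flip: powr_add)
    have "2 * ((z powr \<eta> - 1) / \<eta>) + 2 * ln z = (2 * (w - 1) + 2 * ln w) / \<eta>"
      using \<eta> by (simp add: w w_def field_simps)
    also have "\<dots> \<le> (9/10 * w\<^sup>2) / \<eta>"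
      using small_primes_budget[OF w(1)] \<eta> by (intro divide_right_mono) auto
    finally show ?thesis using w by simp
  qed
  finally have "ln (gcd_form \<alpha> B / card B) \<le> 2 * (T / sqrt \<delta>) + 2 * small_prime_const + 9/10 * (X powr (\<eta> / 2) / \<eta>)
     + 1/10 * (X powr (\<eta> / 2) / \<eta>) + 8 * (T / \<eta>) + 25/6 * (T / sqrt \<delta>)" by simp
  also have "\<dots> \<le> (8 / \<eta> + 8 / sqrt \<delta>) * X powr \<eta> * L powr (- \<alpha>) + 1 / \<eta> * X powr (\<eta> / 2) + 2 * small_prime_const"
  proof -
    have "0 \<le> T / sqrt \<delta>" using T(2) \<delta>(1) by simp
    then have "2 * (T / sqrt \<delta>) + 25/6 * (T / sqrt \<delta>) \<le> 8 * (T / sqrt \<delta>)" by linarith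
    moreover have "(8 / \<eta> + 8 / sqrt \<delta>) * X powr \<eta> * L powr (- \<alpha>) = 8 * (T / \<eta>) + 8 * (T / sqrt \<delta>)"
      by (simp add: T_def algebra_simps)
    ultimately show ?thesis by simp
  qed
  finally show ?thesis by (simp add: \<eta>_def \<delta>_def)
qed

text \<open>Here 1 / sqrt (2 \<alpha> - 1) >= X^(1/4), a power of X that outweighs all powers of L
  lost in comparing with 15 sqrt (X L), the bound at exponent 1/2. Moreover (2 \<alpha> - 1) L <= 1,
  so X^(1/2) and X^(1 - \<alpha>) differ by a factor of at most 2.\<close>

lemma ln_gcd_form_le_just_above_half:
  assumes B: "finite B" "B \<noteq> {}" "0 \<notin> B" and X: "X = ln (card B)" and L: "L = ln X" "L \<ge> 10000"
    and \<alpha>: "1/2 < \<alpha>" "\<alpha> < 1" and small: "2 * \<alpha> - 1 \<le> 1 / sqrt X"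
  shows "ln (gcd_form \<alpha> B / card B) \<le> 8 / sqrt (2 * \<alpha> - 1) * X powr (1 - \<alpha>) * L powr (- \<alpha>)"
proof -
  have "X \<ge> 0" using B by (simp add: X Suc_leI card_gt_0_iff)
  then have "X > 0" using L by (cases "X = 0") auto
  have X_exp: "X powr t = exp (t * L)" for t using L \<open>X > 0\<close> by (simp add: powr_def)
  define \<delta> where "\<delta> = 2 * \<alpha> - 1"
  have \<delta>: "0 < \<delta>" "\<delta> \<le> 1 / sqrt X" using \<alpha> small by (auto simp: \<delta>_def)
  have N: "real (card B) > 0" using B by (simp add: card_gt_0_iff)
  have S: "gcd_form s B / card B > 0" for s using gcd_form_ge_card[OF B(1,3), of s] N by simp
  \<comment> \<open>A cube is chosen to beat 15 L^2: the inequality 15 L^2 <= 4 (L / 12)^3 holds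
    from L = 6480 on, which the threshold 10000 covers.\<close>
  have cube: "(L / 12) ^ 3 \<le> X powr (1/4)"
  proof -
    have "(L / 12) ^ 3 \<le> exp (L / 12) ^ 3"
      using L exp_ge_add_one_self[of "L / 12"] by (intro power_mono) linarith+
    also have "\<dots> = X powr (1/4)" by (simp add: X_exp flip: exp_of_nat_mult)
    finally show ?thesis .
  qed
  have "ln (gcd_form \<alpha> B / card B) \<le> ln (gcd_form (1/2) B / card B)"
    using S[of \<alpha>] gcd_form_antimono[OF B(3), of "1/2" \<alpha>] \<alpha> N by (intro ln_mono divide_right_mono) auto
  also have "\<dots> \<le> 30 * (1/2) * sqrt (X * L) + (1 - 2 * (1/2)) * X"
    using L by (intro ln_gcd_form_le_below_half[OF B X L(1)]) auto
  also have "\<dots> = 15 * (X powr (1/2) * sqrt L)"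
    using \<open>X > 0\<close> by (simp add: real_sqrt_mult powr_half_sqrt)
  also have "\<dots> \<le> 15 * (X powr (1/2) * L)"
  proof -
    have "sqrt L \<le> sqrt (L * L)" using L by (intro real_sqrt_le_mono) simp
    then show ?thesis using L by (intro mult_left_mono) auto
  qed
  also have "\<dots> \<le> 4 * X powr (1/4) * X powr (1/2) * (1 / L)"
  proof -
    have "15 * L * L \<le> 4 * (L / 12) ^ 3"
      using L by (simp add: power3_eq_cube mult_right_mono)
    also have "\<dots> \<le> 4 * X powr (1/4)" using cube by simp
    finally have "(15 * L * L) * (X powr (1/2) / L) \<le> (4 * X powr (1/4)) * (X powr (1/2) / L)"
      using L by (intro mult_right_mono) auto
    then show ?thesis using L by (simp add: mult_ac)
  qed
  also have "\<dots> \<le> 8 * X powr (1/4) * X powr (1 - \<alpha>) * L powr (- \<alpha>)"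
  proof -
    have "L * X powr (- 1/2) \<le> 1"
    proof -
      have "L \<le> exp (L / 2)"
      proof -
        have "0 \<le> (1 - L / 4)\<^sup>2" by simp
        then have "L \<le> (1 + L / 4)\<^sup>2" by (simp add: power2_eq_square algebra_simps)
        also have "\<dots> \<le> exp (L / 4) ^ 2" using L exp_ge_add_one_self[of "L/4"] by (intro power_mono) auto
        also have "\<dots> = exp (L / 2)" by (simp flip: exp_of_nat_mult)
        finally show ?thesis .
      qed
      then show ?thesis by (simp add: X_exp exp_minus field_simps)
    qed
    then have dL: "\<delta> * L \<le> 1"
    proof -
      have "\<delta> * L \<le> 1 / sqrt X * L" using \<delta> L by (intro mult_right_mono) auto
      also have "\<dots> = L * X powr (- 1/2)" using \<open>X > 0\<close> by (simp add: powr_minus_divide powr_half_sqrt)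
      finally show ?thesis using \<open>L * X powr (- 1/2) \<le> 1\<close> by simp
    qed
    have "X powr (1/2) \<le> 2 * X powr (1 - \<alpha>)"
    proof -
      have "X powr (1/2) = X powr (1 - \<alpha>) * exp (\<delta> * L / 2)"
        by (simp add: X_exp \<delta>_def algebra_simps diff_divide_distrib flip: exp_add)
      also have "\<dots> \<le> X powr (1 - \<alpha>) * exp (1/2)" using dL by (intro mult_left_mono) auto
      also have "\<dots> \<le> X powr (1 - \<alpha>) * 2" using exp_half_le2 by (intro mult_left_mono) auto
      finally show ?thesis by simp
    qed
    moreover have "1 / L \<le> L powr (- \<alpha>)"
    proof -
      have "L powr (- 1) \<le> L powr (- \<alpha>)" using L \<alpha> by (intro powr_mono) auto
      then show ?thesis using L by (simp add: powr_minus_divide)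
    qed
    ultimately have "4 * X powr (1/4) * X powr (1/2) * (1 / L) \<le> 4 * X powr (1/4) * (2 * X powr (1 - \<alpha>)) * L powr (- \<alpha>)"
      using L by (intro mult_mono) auto
    then show ?thesis by simp
  qed
  also have "\<dots> \<le> 8 * (1 / sqrt \<delta>) * X powr (1 - \<alpha>) * L powr (- \<alpha>)"
  proof -
    have "sqrt \<delta> \<le> sqrt (1 / sqrt X)" using \<delta> by (intro real_sqrt_le_mono) auto
    also have "\<dots> = 1 / X powr (1/4)"
      using \<open>X > 0\<close> by (simp add: real_sqrt_divide powr_half_sqrt[symmetric] powr_powr)
    finally have "X powr (1/4) \<le> 1 / sqrt \<delta>"
      using \<delta> \<open>X > 0\<close> by (simp add: field_simps)
    then show ?thesis by (intro mult_right_mono mult_left_mono) auto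
  qed
  finally show ?thesis by (simp add: \<delta>_def)
qed

section \<open>Assembling both ranges of the exponent\<close>

lemma ln_gcd_form_le_g:
  assumes B: "finite B" "0 \<notin> B" and large: "ln (ln (card B)) \<ge> 10000" "card B > 1"
    and \<alpha>: "0 < \<alpha>" "\<alpha> < 1"
  shows "ln (gcd_form \<alpha> B / card B) \<le> g \<alpha> (card B) + 2 * small_prime_const"
proof -
  define X where "X = ln (real (card B))"
  define L where "L = ln X"
  have L: "L \<ge> 10000" using large by (simp add: L_def X_def)
  have ne: "B \<noteq> {}" using large by auto
  show ?thesis
  proof (cases "\<alpha> \<le> 1/2")
    case True
    have "ln (gcd_form \<alpha> B / card B) \<le> 30 * \<alpha> * sqrt (X * L) + (1 - 2 * \<alpha>) * X"
      using L True \<alpha> by (intro ln_gcd_form_le_below_half[OF B(1) ne B(2) X_def L_def]) auto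
    also have "\<dots> \<le> 50 * \<alpha> * sqrt (X * L) + (1 - 2 * \<alpha>) * X"
      using \<alpha> large L by (intro add_right_mono mult_right_mono) (auto simp: X_def)
    finally show ?thesis using True small_prime_const_nonneg by (simp add: g_def X_def L_def)
  next
    case False
    define T where "T = X powr (1 - \<alpha>) * L powr (- \<alpha>)"
    have "T \<ge> 0" by (simp add: T_def)
    \<comment> \<open>Since 2^-\<alpha> >= 1/2 for \<alpha> < 1, the coefficient 8 obtained above
      fits into the one in \<open>g\<close>.\<close>
    have "8 \<le> 16 * 2 powr (- \<alpha>)"
    proof -
      have "2 powr (- 1) \<le> 2 powr (- \<alpha>)" using \<alpha> by (intro powr_mono) auto
      moreover have "2 powr (- 1) = (1/2 :: real)" by (simp add: powr_minus_divide)
      ultimately show ?thesis by linarith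
    qed
    then have "8 / sqrt (2 * \<alpha> - 1) \<le> 16 * 2 powr (- \<alpha>) / sqrt (2 * \<alpha> - 1)"
      using False by (intro divide_right_mono) auto
    then have *: "(8 / (1 - \<alpha>) + 8 / sqrt (2 * \<alpha> - 1)) * T \<le> (8 / (1 - \<alpha>) + 16 * 2 powr (- \<alpha>) / sqrt (2 * \<alpha> - 1)) * T"
      using \<open>T \<ge> 0\<close> by (intro mult_right_mono) auto
    have "ln (gcd_form \<alpha> B / card B) \<le> (8 / (1 - \<alpha>) + 8 / sqrt (2 * \<alpha> - 1)) * T + 1 / (1 - \<alpha>) * X powr ((1 - \<alpha>) / 2)
      + 2 * small_prime_const"
    proof (cases "1 / sqrt X \<le> 2 * \<alpha> - 1")
      case True
      then show ?thesis
        using ln_gcd_form_le_above_half[OF B(1) ne B(2) X_def L_def L _ _ True] False \<alpha> by (simp add: T_def mult.assoc)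
    next
      case 2: False
      then have "ln (gcd_form \<alpha> B / card B) \<le> 8 / sqrt (2 * \<alpha> - 1) * T"
        using ln_gcd_form_le_just_above_half[OF B(1) ne B(2) X_def L_def L, of \<alpha>] False \<alpha> by (simp add: T_def mult.assoc)
      moreover have "0 \<le> 8 / (1 - \<alpha>) * T" "0 \<le> 1 / (1 - \<alpha>) * X powr ((1 - \<alpha>) / 2)"
        using \<alpha> \<open>T \<ge> 0\<close> by auto
      ultimately show ?thesis using small_prime_const_nonneg by (simp add: distrib_right)
    qed
    also have "\<dots> \<le> g \<alpha> (card B) + 2 * small_prime_const"
      using * False by (simp add: g_def T_def X_def L_def mult.assoc)
    finally show ?thesis .
  qed
qed

text \<open>N >= 3 > e makes ln N >= 1 and ln (ln N) >= 0. Nonnegativity is what permits the factor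
  1 + \<epsilon> and the trivial estimate for small N.\<close>

lemma g_nonneg:
  assumes "0 < \<alpha>" "\<alpha> < 1" "3 \<le> N"
  shows "0 \<le> g \<alpha> N"
proof -
  have "exp 1 \<le> real N" using exp_le assms by linarith
  then have "1 \<le> ln (real N)" using assms by (simp add: ln_ge_iff)
  then show ?thesis using assms by (auto simp: g_def)
qed

theorem theorem1:
  shows "\<forall>\<epsilon>::real. \<epsilon> > 0 \<longrightarrow>
    (\<exists>C::real. C > 0 \<and>
      (\<forall>(\<alpha>::real) (N::nat) (n :: nat \<Rightarrow> nat).
         0 < \<alpha> \<longrightarrow> \<alpha> < 1 \<longrightarrow> N \<ge> 3 \<longrightarrow>
         inj_on n {1..N} \<longrightarrow> (\<forall>k\<in>{1..N}. n k > 0) \<longrightarrow>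
         1 / real N * gcd_sum \<alpha> N n \<le> C * exp ((1 + \<epsilon>) * g \<alpha> N)))"
proof (intro allI impI)
  fix \<epsilon> :: real assume \<epsilon>: "\<epsilon> > 0"
  \<comment> \<open>Beyond N0 one has ln (ln N) >= 10000. Up to N0 the normalized sum is at most N,
    hence at most N0; the other summand of C absorbs the primes 2 and 3.\<close>
  define N0 where "N0 = exp (exp (10000::real))"
  define C where "C = N0 + exp (2 * small_prime_const)"
  have "N0 > 0" by (simp add: N0_def)
  have "C > 0" using \<open>N0 > 0\<close> by (auto simp: C_def intro: add_pos_pos)
  moreover have "1 / real N * gcd_sum \<alpha> N n \<le> C * exp ((1 + \<epsilon>) * g \<alpha> N)"
    if \<alpha>: "0 < \<alpha>" "\<alpha> < 1" and N: "N \<ge> 3" and n: "inj_on n {1..N}" "\<forall>k\<in>{1..N}. n k > 0" for \<alpha> N n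
  proof -
    define B where "B = n ` {1..N}"
    have B: "finite B" "0 \<notin> B" "card B = N" using n by (auto simp: B_def card_image)
    have form: "gcd_sum \<alpha> N n = gcd_form \<alpha> B"
      using n(1) by (simp add: gcd_sum_def gcd_form_def B_def sum.reindex)
    have g: "0 \<le> g \<alpha> N" "g \<alpha> N \<le> (1 + \<epsilon>) * g \<alpha> N"
      using g_nonneg[OF \<alpha> N] \<epsilon> by (auto simp: distrib_right)
    have S: "1 \<le> gcd_form \<alpha> B / N"
      using gcd_form_ge_card[OF B(1,2), of \<alpha>] B N by simp
    have "gcd_form \<alpha> B / N \<le> C * exp ((1 + \<epsilon>) * g \<alpha> N)"
    proof (cases "real N \<le> N0")
      case True
      have "gcd_form \<alpha> B / N \<le> real N"
        using gcd_form_le_card_squared[OF B(2), of \<alpha>] \<alpha> B N by (simp add: divide_le_eq power2_eq_square)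
      also have "\<dots> \<le> C * 1" using True by (simp add: C_def add_increasing2)
      also have "\<dots> \<le> C * exp ((1 + \<epsilon>) * g \<alpha> N)"
        using \<open>C > 0\<close> g by (intro mult_left_mono) auto
      finally show ?thesis .
    next
      case False
      then have 1: "exp 10000 \<le> ln (real N)" using N by (simp add: N0_def ln_ge_iff)
      then have "0 < ln (real N)" using exp_gt_zero less_le_trans by blast
      with 1 have 2: "10000 \<le> ln (ln (real N))" by (simp add: ln_ge_iff)
      have "ln (gcd_form \<alpha> B / card B) \<le> g \<alpha> (card B) + 2 * small_prime_const"
        using 2 \<open>0 < ln (real N)\<close> N \<alpha> B by (intro ln_gcd_form_le_g) auto
      then have "exp (ln (gcd_form \<alpha> B / N)) \<le> exp ((1 + \<epsilon>) * g \<alpha> N + 2 * small_prime_const)"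
        using g B by simp
      then have "gcd_form \<alpha> B / N \<le> exp (2 * small_prime_const) * exp ((1 + \<epsilon>) * g \<alpha> N)"
        using S by (simp add: exp_add mult.commute)
      also have "\<dots> \<le> C * exp ((1 + \<epsilon>) * g \<alpha> N)"
        using \<open>N0 > 0\<close> by (intro mult_right_mono) (auto simp: C_def)
      finally show ?thesis .
    qed
    then show ?thesis using form by simp
  qed
  ultimately show "\<exists>C>0. \<forall>\<alpha> N n. 0 < \<alpha> \<longrightarrow> \<alpha> < 1 \<longrightarrow> 3 \<le> N \<longrightarrow> inj_on n {1..N} \<longrightarrow> (\<forall>k\<in>{1..N}. 0 < n k) \<longrightarrow>
      1 / real N * gcd_sum \<alpha> N n \<le> C * exp ((1 + \<epsilon>) * g \<alpha> N)"
    by blast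
qed

end
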